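(* Let $H$ be a finite-dimensional cocommutative Hopf algebra, $(A,\cdot,(\omega,\omega'))$ a symmetric twisted partial $H$-module algebra, and $t\neq0$ a left integral in $H$. Assume there exists $c$ in the center of $A$ with $t\cdot c=1_A$. Then $A\subset A\#_{\cdot,\omega}H$ is a separable extension, i.e. there exists $e\in (A\#_{\cdot,\omega}H)\otimes_A(A\#_{\cdot,\omega}H)$ with $(x\otimes_A 1)e=e(1\otimes_A x)$ for all $x\in A\#_{\cdot,\omega}H$ and $m(e)=1_A\#1_H$, where $m$ is the multiplication map.
   Context: $k$ a field, $H$ a Hopf algebra with Sweedler notation $\Delta(h)=h_{(1)}\otimes h_{(2)}$, counit $\varepsilon$, antipode $S$; a left integral is $t\in H$ with $ht=\varepsilon(h)t$ for all $h$. $A$ a unital algebra. A twisted partial action: linear maps $h\otimes a\mapsto h\cdot a$, $\omega:H\otimes H\to A$ with $1_H\cdot a=a$, $h\cdot(ab)=(h_{(1)}\cdot a)(h_{(2)}\cdot b)$, (T3) $(h_{(1)}\cdot(l_{(1)}\cdot a))\omega(h_{(2)},l_{(2)})=\omega(h_{(1)},l_{(1)})(h_{(2)}l_{(2)}\cdot a)$, $\omega(h,l)=\omega(h_{(1)},l_{(1)})(h_{(2)}l_{(2)}\cdot 1_A)$; (N) $\omega(1_H,h)=\omega(h,1_H)=h\cdot 1_A$; (C) $(h_{(1)}\cdot\omega(l_{(1)},m_{(1)}))\omega(h_{(2)},l_{(2)}m_{(2)})=\omega(h_{(1)},l_{(1)})\omega(h_{(2)}l_{(2)},m)$. $A\#_{\cdot,\omega}H$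 is the span in $A\otimes H$ of $a\# h:=a(h_{(1)}\cdot 1_A)\otimes h_{(2)}$ with product $(a\otimes h)(b\otimes l)=a(h_{(1)}\cdot b)\omega(h_{(2)},l_{(1)})\otimes h_{(3)}l_{(2)}$, a unital associative algebra containing $A$ via $a\mapsto a\#1_H$. Convolution: $(f*g)(h)=f(h_{(1)})g(h_{(2)})$. With $e(h)=h\cdot1_A$, $f_1(h,k)=(h\cdot 1_A)\varepsilon(k)$, $f_2(h,k)=hk\cdot1_A$, the twisted partial action is symmetric if $e$ is central in $\mathrm{Hom}(H,A)$, $f_1,f_2$ are central in $\mathrm{Hom}(H\otimes H,A)$, $\omega$ satisfies (N),(T3),(C) and has a convolution inverse $\omega'$ with $\omega*\omega'=\omega'*\omega=f_1*f_2$, and $h\cdot(k\cdot1_A)=(h_{(1)}\cdot1_A)(h_{(2)}k\cdot1_A)$ for all $h,k\in H$. *)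

theory Defs
  imports Main
begin

text \<open>A finite-dimensional Hopf algebra H over a field 'k is given by a finite basis
  indexed by the finite type 'i; elements of H are coordinate vectors 'i => 'k.
  hmu i j l: coefficient of b_l in b_i b_j; hun: coordinates of 1_H;
  hcom l i j: coefficient of b_i (x) b_j in Delta(b_l); hcou l = eps(b_l);
  hant i j: coefficient of b_j in S(b_i).\<close>

record ('i, 'k) hopf_data =
  hmu  :: "'i \<Rightarrow> 'i \<Rightarrow> 'i \<Rightarrow> 'k"
  hun  :: "'i \<Rightarrow> 'k"
  hcom :: "'i \<Rightarrow> 'i \<Rightarrow> 'i \<Rightarrow> 'k"
  hcou :: "'i \<Rightarrow> 'k"
  hant :: "'i \<Rightarrow> 'i \<Rightarrow> 'k"

definition bas :: "'i \<Rightarrow> 'i \<Rightarrow> 'k::field" where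
  "bas i = (\<lambda>j. if j = i then 1 else 0)"

definition hadd :: "('i \<Rightarrow> 'k::field) \<Rightarrow> ('i \<Rightarrow> 'k) \<Rightarrow> ('i \<Rightarrow> 'k)" where
  "hadd x y = (\<lambda>i. x i + y i)"

definition hsc :: "'k::field \<Rightarrow> ('i \<Rightarrow> 'k) \<Rightarrow> ('i \<Rightarrow> 'k)" where
  "hsc c x = (\<lambda>i. c * x i)"

definition hmul :: "('i::finite, 'k::field) hopf_data \<Rightarrow> ('i \<Rightarrow> 'k) \<Rightarrow> ('i \<Rightarrow> 'k) \<Rightarrow> ('i \<Rightarrow> 'k)" where
  "hmul H x y = (\<lambda>l. \<Sum>i\<in>UNIV. \<Sum>j\<in>UNIV. x i * y j * hmu H i j l)"

definition hone :: "('i::finite, 'k::field) hopf_data \<Rightarrow> ('i \<Rightarrow> 'k)" where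
  "hone H = hun H"

definition cop :: "('i::finite, 'k::field) hopf_data \<Rightarrow> ('i \<Rightarrow> 'k) \<Rightarrow> ('i \<times> 'i \<Rightarrow> 'k)" where
  "cop H x = (\<lambda>(i, j). \<Sum>l\<in>UNIV. x l * hcom H l i j)"

text \<open>(Delta (x) id) Delta(x) in H (x) H (x) H (i.e. x_(1) (x) x_(2) (x) x_(3)).\<close>
definition cop3 :: "('i::finite, 'k::field) hopf_data \<Rightarrow> ('i \<Rightarrow> 'k) \<Rightarrow> ('i \<times> 'i \<times> 'i \<Rightarrow> 'k)" where
  "cop3 H x = (\<lambda>(p, q, r). \<Sum>l\<in>UNIV. \<Sum>u\<in>UNIV. x l * hcom H l u r * hcom H u p q)"

definition eps :: "('i::finite, 'k::field) hopf_data \<Rightarrow> ('i \<Rightarrow> 'k) \<Rightarrow> 'k" where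
  "eps H x = (\<Sum>l\<in>UNIV. x l * hcou H l)"

definition ant :: "('i::finite, 'k::field) hopf_data \<Rightarrow> ('i \<Rightarrow> 'k) \<Rightarrow> ('i \<Rightarrow> 'k)" where
  "ant H x = (\<lambda>j. \<Sum>i\<in>UNIV. x i * hant H i j)"

definition is_hopf :: "('i::finite, 'k::field) hopf_data \<Rightarrow> bool" where
  "is_hopf H \<longleftrightarrow>
     (\<forall>x y z. hmul H (hmul H x y) z = hmul H x (hmul H y z)) \<and>
     (\<forall>x. hmul H (hone H) x = x \<and> hmul H x (hone H) = x) \<and>
     (\<forall>x p q r. (\<Sum>u\<in>UNIV. cop H x (u, r) * cop H (bas u) (p, q))
              = (\<Sum>v\<in>UNIV. cop H x (p, v) * cop H (bas v) (q, r))) \<and>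
     (\<forall>x. (\<lambda>j. \<Sum>i\<in>UNIV. cop H x (i, j) * eps H (bas i)) = x \<and>
          (\<lambda>i. \<Sum>j\<in>UNIV. cop H x (i, j) * eps H (bas j)) = x) \<and>
     (\<forall>x y p q. cop H (hmul H x y) (p, q) =
        (\<Sum>i\<in>UNIV. \<Sum>j\<in>UNIV. \<Sum>i'\<in>UNIV. \<Sum>j'\<in>UNIV.
           cop H x (i, j) * cop H y (i', j') * hmul H (bas i) (bas i') p * hmul H (bas j) (bas j') q)) \<and>
     (\<forall>p q. cop H (hone H) (p, q) = hone H p * hone H q) \<and>
     (\<forall>x y. eps H (hmul H x y) = eps H x * eps H y) \<and>
     eps H (hone H) = 1 \<and>
     (\<forall>x. (\<lambda>l. \<Sum>i\<in>UNIV. \<Sum>j\<in>UNIV. cop H x (i, j) * hmul H (ant H (bas i)) (bas j) l)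
            = (\<lambda>l. eps H x * hone H l) \<and>
          (\<lambda>l. \<Sum>i\<in>UNIV. \<Sum>j\<in>UNIV. cop H x (i, j) * hmul H (bas i) (ant H (bas j)) l)
            = (\<lambda>l. eps H x * hone H l))"

definition cocommutative :: "('i::finite, 'k::field) hopf_data \<Rightarrow> bool" where
  "cocommutative H \<longleftrightarrow> (\<forall>x i j. cop H x (i, j) = cop H x (j, i))"

definition left_integral :: "('i::finite, 'k::field) hopf_data \<Rightarrow> ('i \<Rightarrow> 'k) \<Rightarrow> bool" where
  "left_integral H t \<longleftrightarrow> (\<forall>h. hmul H h t = (\<lambda>l. eps H h * t l))"

definition kalg :: "('k::field \<Rightarrow> 'a::ring_1) \<Rightarrow> bool" where
  "kalg \<phi> \<longleftrightarrow> (\<forall>x y. \<phi> (x + y) = \<phi> x + \<phi> y) \<and> (\<forall>x y. \<phi> (x * y) = \<phi> x * \<phi> y) \<and>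
     \<phi> 1 = 1 \<and> (\<forall>c a. \<phi> c * a = a * \<phi> c)"

definition hlin :: "('k::field \<Rightarrow> 'a::ring_1) \<Rightarrow> (('i \<Rightarrow> 'k) \<Rightarrow> 'a) \<Rightarrow> bool" where
  "hlin \<phi> f \<longleftrightarrow> (\<forall>x y c. f (hadd x y) = f x + f y \<and> f (hsc c x) = \<phi> c * f x)"

definition hbilin :: "('k::field \<Rightarrow> 'a::ring_1) \<Rightarrow> (('i \<Rightarrow> 'k) \<Rightarrow> ('i \<Rightarrow> 'k) \<Rightarrow> 'a) \<Rightarrow> bool" where
  "hbilin \<phi> f \<longleftrightarrow> (\<forall>x. hlin \<phi> (f x)) \<and> (\<forall>y. hlin \<phi> (\<lambda>x. f x y))"

definition alin :: "('k::field \<Rightarrow> 'a::ring_1) \<Rightarrow> ('a \<Rightarrow> 'a) \<Rightarrow> bool" where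
  "alin \<phi> g \<longleftrightarrow> (\<forall>a b c. g (a + b) = g a + g b \<and> g (\<phi> c * a) = \<phi> c * g a)"

text \<open>sw2 H phi h F = F(h_(1), h_(2)) (summed), for F bilinear; sw3 likewise with three legs.\<close>
definition sw2 :: "('i::finite, 'k::field) hopf_data \<Rightarrow> ('k \<Rightarrow> 'a::ring_1) \<Rightarrow> ('i \<Rightarrow> 'k)
    \<Rightarrow> (('i \<Rightarrow> 'k) \<Rightarrow> ('i \<Rightarrow> 'k) \<Rightarrow> 'a) \<Rightarrow> 'a" where
  "sw2 H \<phi> h F = (\<Sum>p\<in>UNIV. \<phi> (cop H h p) * F (bas (fst p)) (bas (snd p)))"

definition sw3 :: "('i::finite, 'k::field) hopf_data \<Rightarrow> ('k \<Rightarrow> 'a::ring_1) \<Rightarrow> ('i \<Rightarrow> 'k)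
    \<Rightarrow> (('i \<Rightarrow> 'k) \<Rightarrow> ('i \<Rightarrow> 'k) \<Rightarrow> ('i \<Rightarrow> 'k) \<Rightarrow> 'a) \<Rightarrow> 'a" where
  "sw3 H \<phi> h F = (\<Sum>p\<in>UNIV. \<phi> (cop3 H h p) * F (bas (fst p)) (bas (fst (snd p))) (bas (snd (snd p))))"

text \<open>Convolution in Hom(H,A) and in Hom(H (x) H, A) (the latter represented by bilinear maps).\<close>
definition conv1 where
  "conv1 H \<phi> f g = (\<lambda>h. sw2 H \<phi> h (\<lambda>h1 h2. f h1 * g h2))"

definition conv2 where
  "conv2 H \<phi> f g = (\<lambda>h l. sw2 H \<phi> h (\<lambda>h1 h2. sw2 H \<phi> l (\<lambda>l1 l2. f h1 l1 * g h2 l2)))"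

definition tpa :: "('i::finite, 'k::field) hopf_data \<Rightarrow> ('k \<Rightarrow> 'a::ring_1)
    \<Rightarrow> (('i \<Rightarrow> 'k) \<Rightarrow> 'a \<Rightarrow> 'a) \<Rightarrow> (('i \<Rightarrow> 'k) \<Rightarrow> ('i \<Rightarrow> 'k) \<Rightarrow> 'a) \<Rightarrow> bool" where
  "tpa H \<phi> act om \<longleftrightarrow>
     (\<forall>a. hlin \<phi> (\<lambda>h. act h a)) \<and> (\<forall>h. alin \<phi> (act h)) \<and> hbilin \<phi> om \<and>
     (\<forall>a. act (hone H) a = a) \<and>
     (\<forall>h a b. act h (a * b) = sw2 H \<phi> h (\<lambda>h1 h2. act h1 a * act h2 b)) \<and>
     (\<forall>h l a. sw2 H \<phi> h (\<lambda>h1 h2. sw2 H \<phi> l (\<lambda>l1 l2. act h1 (act l1 a) * om h2 l2))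
            = sw2 H \<phi> h (\<lambda>h1 h2. sw2 H \<phi> l (\<lambda>l1 l2. om h1 l1 * act (hmul H h2 l2) a))) \<and>
     (\<forall>h l. om h l = sw2 H \<phi> h (\<lambda>h1 h2. sw2 H \<phi> l (\<lambda>l1 l2. om h1 l1 * act (hmul H h2 l2) 1)))"

definition sym_tpa :: "('i::finite, 'k::field) hopf_data \<Rightarrow> ('k \<Rightarrow> 'a::ring_1)
    \<Rightarrow> (('i \<Rightarrow> 'k) \<Rightarrow> 'a \<Rightarrow> 'a) \<Rightarrow> (('i \<Rightarrow> 'k) \<Rightarrow> ('i \<Rightarrow> 'k) \<Rightarrow> 'a)
    \<Rightarrow> (('i \<Rightarrow> 'k) \<Rightarrow> ('i \<Rightarrow> 'k) \<Rightarrow> 'a) \<Rightarrow> bool" where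
  "sym_tpa H \<phi> act om om' \<longleftrightarrow>
     tpa H \<phi> act om \<and>
     \<comment> \<open>e central in Hom(H,A)\<close>
     (\<forall>f. hlin \<phi> f \<longrightarrow> conv1 H \<phi> (\<lambda>h. act h 1) f = conv1 H \<phi> f (\<lambda>h. act h 1)) \<and>
     \<comment> \<open>f1 and f2 central in Hom(H (x) H, A)\<close>
     (\<forall>f. hbilin \<phi> f \<longrightarrow>
        conv2 H \<phi> (\<lambda>h l. act h 1 * \<phi> (eps H l)) f = conv2 H \<phi> f (\<lambda>h l. act h 1 * \<phi> (eps H l))) \<and>
     (\<forall>f. hbilin \<phi> f \<longrightarrow>
        conv2 H \<phi> (\<lambda>h l. act (hmul H h l) 1) f = conv2 H \<phi> f (\<lambda>h l. act (hmul H h l) 1)) \<and>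
     \<comment> \<open>(N)\<close>
     (\<forall>h. om (hone H) h = act h 1 \<and> om h (hone H) = act h 1) \<and>
     \<comment> \<open>(C)\<close>
     (\<forall>h l m. sw2 H \<phi> h (\<lambda>h1 h2. sw2 H \<phi> l (\<lambda>l1 l2. sw2 H \<phi> m (\<lambda>m1 m2.
                 act h1 (om l1 m1) * om h2 (hmul H l2 m2))))
            = sw2 H \<phi> h (\<lambda>h1 h2. sw2 H \<phi> l (\<lambda>l1 l2. om h1 l1 * om (hmul H h2 l2) m))) \<and>
     \<comment> \<open>convolution inverse om'\<close>
     hbilin \<phi> om' \<and>
     conv2 H \<phi> om om' = conv2 H \<phi> (\<lambda>h l. act h 1 * \<phi> (eps H l)) (\<lambda>h l. act (hmul H h l) 1) \<and>
     conv2 H \<phi> om' om = conv2 H \<phi> (\<lambda>h l. act h 1 * \<phi> (eps H l)) (\<lambda>h l. act (hmul H h l) 1) \<and>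
     \<comment> \<open>symmetry condition\<close>
     (\<forall>h k. act h (act k 1) = sw2 H \<phi> h (\<lambda>h1 h2. act h1 1 * act (hmul H h2 k) 1))"

text \<open>A (x) H is represented by coordinate vectors 'i => 'a: x = sum_i x_i (x) b_i.\<close>

definition sharp :: "('i::finite, 'k::field) hopf_data \<Rightarrow> ('k \<Rightarrow> 'a::ring_1)
    \<Rightarrow> (('i \<Rightarrow> 'k) \<Rightarrow> 'a \<Rightarrow> 'a) \<Rightarrow> 'a \<Rightarrow> ('i \<Rightarrow> 'k) \<Rightarrow> ('i \<Rightarrow> 'a)" where
  "sharp H \<phi> act a h = (\<lambda>m. sw2 H \<phi> h (\<lambda>h1 h2. a * act h1 1 * \<phi> (h2 m)))"

definition smash_set :: "('i::finite, 'k::field) hopf_data \<Rightarrow> ('k \<Rightarrow> 'a::ring_1)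
    \<Rightarrow> (('i \<Rightarrow> 'k) \<Rightarrow> 'a \<Rightarrow> 'a) \<Rightarrow> ('i \<Rightarrow> 'a) set" where
  "smash_set H \<phi> act =
     {x. \<exists>(n::nat) (a :: nat \<Rightarrow> 'a) (h :: nat \<Rightarrow> 'i \<Rightarrow> 'k).
           x = (\<lambda>m. \<Sum>j<n. sharp H \<phi> act (a j) (h j) m)}"

definition smul :: "('i::finite, 'k::field) hopf_data \<Rightarrow> ('k \<Rightarrow> 'a::ring_1)
    \<Rightarrow> (('i \<Rightarrow> 'k) \<Rightarrow> 'a \<Rightarrow> 'a) \<Rightarrow> (('i \<Rightarrow> 'k) \<Rightarrow> ('i \<Rightarrow> 'k) \<Rightarrow> 'a)
    \<Rightarrow> ('i \<Rightarrow> 'a) \<Rightarrow> ('i \<Rightarrow> 'a) \<Rightarrow> ('i \<Rightarrow> 'a)" where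
  "smul H \<phi> act om x y = (\<lambda>m. \<Sum>i\<in>UNIV. \<Sum>j\<in>UNIV.
      sw3 H \<phi> (bas i) (\<lambda>h1 h2 h3. sw2 H \<phi> (bas j) (\<lambda>l1 l2.
        x i * act h1 (y j) * om h2 l1 * \<phi> (hmul H h3 l2 m))))"

definition delta :: "'z \<Rightarrow> 'z \<Rightarrow> int" where
  "delta z = (\<lambda>w. if w = z then 1 else 0)"

text \<open>Elements of the free abelian group on Ms x Ns are finitely supported integer-valued
  functions; tensor_zero is the subgroup generated by the biadditivity and balancing relations,
  so M (x)_R N is the quotient by it.\<close>
inductive_set tensor_zero :: "'m set \<Rightarrow> 'n set \<Rightarrow> ('m \<Rightarrow> 'm \<Rightarrow> 'm) \<Rightarrow> ('n \<Rightarrow> 'n \<Rightarrow> 'n)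
    \<Rightarrow> ('m \<Rightarrow> 'r \<Rightarrow> 'm) \<Rightarrow> ('r \<Rightarrow> 'n \<Rightarrow> 'n) \<Rightarrow> ('m \<times> 'n \<Rightarrow> int) set"
  for Ms Ns addM addN ract lact where
  tz_zero: "(\<lambda>_. 0) \<in> tensor_zero Ms Ns addM addN ract lact"
| tz_add: "p \<in> tensor_zero Ms Ns addM addN ract lact \<Longrightarrow> q \<in> tensor_zero Ms Ns addM addN ract lact
           \<Longrightarrow> (\<lambda>z. p z + q z) \<in> tensor_zero Ms Ns addM addN ract lact"
| tz_neg: "p \<in> tensor_zero Ms Ns addM addN ract lact \<Longrightarrow> (\<lambda>z. - p z) \<in> tensor_zero Ms Ns addM addN ract lact"
| tz_l: "x \<in> Ms \<Longrightarrow> x' \<in> Ms \<Longrightarrow> y \<in> Ns \<Longrightarrow>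
         (\<lambda>z. delta (addM x x', y) z - delta (x, y) z - delta (x', y) z) \<in> tensor_zero Ms Ns addM addN ract lact"
| tz_r: "x \<in> Ms \<Longrightarrow> y \<in> Ns \<Longrightarrow> y' \<in> Ns \<Longrightarrow>
         (\<lambda>z. delta (x, addN y y') z - delta (x, y) z - delta (x, y') z) \<in> tensor_zero Ms Ns addM addN ract lact"
| tz_bal: "x \<in> Ms \<Longrightarrow> y \<in> Ns \<Longrightarrow>
         (\<lambda>z. delta (ract x a, y) z - delta (x, lact a y) z) \<in> tensor_zero Ms Ns addM addN ract lact"

definition push :: "('z \<Rightarrow> 'w) \<Rightarrow> ('z \<Rightarrow> int) \<Rightarrow> ('w \<Rightarrow> int)" where
  "push g p = (\<lambda>w. \<Sum>z\<in>{z. p z \<noteq> 0 \<and> g z = w}. p z)"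

definition vadd :: "('i \<Rightarrow> 'a::plus) \<Rightarrow> ('i \<Rightarrow> 'a) \<Rightarrow> ('i \<Rightarrow> 'a)" where
  "vadd x y = (\<lambda>m. x m + y m)"

text \<open>A \<subseteq> B = A #_{.,omega} H is separable: there is e in B (x)_A B, represented by a finitely
  supported formal sum p of pairs in B x B, with (x (x) 1) e = e (1 (x) x) for all x in B
  and m(e) = 1_A # 1_H.\<close>
definition smash_separable :: "('i::finite, 'k::field) hopf_data \<Rightarrow> ('k \<Rightarrow> 'a::ring_1)
    \<Rightarrow> (('i \<Rightarrow> 'k) \<Rightarrow> 'a \<Rightarrow> 'a) \<Rightarrow> (('i \<Rightarrow> 'k) \<Rightarrow> ('i \<Rightarrow> 'k) \<Rightarrow> 'a) \<Rightarrow> bool" where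
  "smash_separable H \<phi> act om \<longleftrightarrow>
     (\<exists>p :: ('i \<Rightarrow> 'a) \<times> ('i \<Rightarrow> 'a) \<Rightarrow> int.
        finite {z. p z \<noteq> 0} \<and>
        {z. p z \<noteq> 0} \<subseteq> smash_set H \<phi> act \<times> smash_set H \<phi> act \<and>
        (\<forall>x\<in>smash_set H \<phi> act.
           (\<lambda>w. push (\<lambda>z. (smul H \<phi> act om x (fst z), snd z)) p w
               - push (\<lambda>z. (fst z, smul H \<phi> act om (snd z) x)) p w)
           \<in> tensor_zero (smash_set H \<phi> act) (smash_set H \<phi> act) vadd vadd
               (\<lambda>x a. smul H \<phi> act om x (sharp H \<phi> act a (hone H)))
               (\<lambda>a y. smul H \<phi> act om (sharp H \<phi> act a (hone H)) y)) \<and>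
        (\<lambda>m. \<Sum>z\<in>{z. p z \<noteq> 0}. of_int (p z) * smul H \<phi> act om (fst z) (snd z) m)
          = sharp H \<phi> act 1 (hone H))"

end

theory Submission
  imports Defs "HOL-Algebra.Group" "HOL-Library.Function_Algebras"
begin

text \<open>
  For a cocommutative coalgebra C the coalgebra maps \<open>u, v : C \<rightarrow> H\<close> form a group, and with
  \<open>(u \<rhd> f)(x) = u(x\<^sub>1) \<cdot> f(x\<^sub>2)\<close> and \<open>\<omega>(u,v)(x) = \<omega>(u(x\<^sub>1), v(x\<^sub>2))\<close> the axioms of a twisted
  partial action become those of a twisted partial action of this group on the convolution algebra
  Hom(C, A). In these terms \<open>\<gamma>(u) = 1 # u\<close> satisfies \<open>\<gamma>(u) f = (u \<rhd> f) \<gamma>(u)\<close> and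
  \<open>\<gamma>(u) \<gamma>(v) = \<omega>(u,v) \<gamma>(uv)\<close>, and \<open>\<gamma>'(u) = \<omega>'(u\<^sup>-\<^sup>1,u) \<gamma>(u\<^sup>-\<^sup>1)\<close> is a partial inverse of it.
  The separability element is \<open>\<gamma>(t\<^sub>1) c \<otimes> \<gamma>'(t\<^sub>2)\<close>. It is mapped to \<open>t \<cdot> c = 1\<close>. Conjugation by
  \<open>\<gamma>\<close> preserves A, so \<open>a \<gamma>(h) \<gamma>(t\<^sub>1) c\<close> can be rewritten as \<open>\<gamma>(h\<^sub>1 t\<^sub>1) c\<close> times an element of A,
  which is moved across the tensor sign; the integral property
  \<open>h\<^sub>1 t\<^sub>1 \<otimes> h\<^sub>2 t\<^sub>2 \<otimes> h\<^sub>3 = t\<^sub>1 \<otimes> t\<^sub>2 \<otimes> h\<close> then gives the commutation with \<open>a # h\<close>.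
\<close>

section \<open>Linear extensions and Sweedler sums\<close>

lemma sum_bas [simp]:
  fixes f :: "'i::finite \<Rightarrow> 'k::field"
  shows "(\<Sum>l\<in>UNIV. bas i l * f l) = f i" "(\<Sum>l\<in>UNIV. f l * bas l i) = f i"
  by (simp_all add: bas_def if_distrib [of "\<lambda>x. x * _"] if_distrib [of "\<lambda>x. _ * x"] cong: if_cong)

lemma bas_Pair: "bas z (p, q) = bas (fst z) p * bas (snd z) q"
  by (auto simp: bas_def prod_eq_iff)

lemma sum_UNIV_prod: "(\<Sum>z\<in>UNIV. f z) = (\<Sum>a\<in>UNIV. \<Sum>b\<in>UNIV. f (a, b))"
  by (simp add: sum.cartesian_product)

lemma sum_fun_apply [simp]: "(\<Sum>s\<in>S. f s) x = (\<Sum>s\<in>S. f s x)"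
  by (induction S rule: infinite_finite_induct) simp_all

locale kalgebra =
  fixes \<phi> :: "'k::field \<Rightarrow> 'a::ring_1"
  assumes kalg: "kalg \<phi>"
begin

lemma phi_add: "\<phi> (x + y) = \<phi> x + \<phi> y"
  and phi_mult: "\<phi> (x * y) = \<phi> x * \<phi> y"
  and phi_one: "\<phi> 1 = 1"
  and phi_central: "\<phi> x * a = a * \<phi> x"
  using kalg unfolding kalg_def by blast+

lemma phi_zero: "\<phi> 0 = 0"
  using phi_add [of 0 0] by simp

lemma phi_sum: "\<phi> (sum f S) = (\<Sum>x\<in>S. \<phi> (f x))"
  by (induction S rule: infinite_finite_induct) (simp_all add: phi_add phi_zero)

lemma phi_left_commute: "a * (\<phi> x * b) = \<phi> x * (a * b)"
  by (simp add: phi_central mult.assoc)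

lemma phi_bas_mult: "\<phi> (bas p q) * f q = (if q = p then f q else 0)"
  by (simp add: bas_def phi_one phi_zero)

text \<open>\<open>lin v f\<close> is the value at the vector \<open>v\<close> of the linear map that sends the p-th basis vector to
  \<open>f p\<close>. For a comultiplication \<open>d\<close>, the sum \<open>bilin (d x) F\<close> is \<open>F(x\<^sub>1, x\<^sub>2)\<close> in Sweedler notation.\<close>

definition lin :: "('p::finite \<Rightarrow> 'k) \<Rightarrow> ('p \<Rightarrow> 'a) \<Rightarrow> 'a" where
  "lin v f = (\<Sum>p\<in>UNIV. \<phi> (v p) * f p)"

definition bilin :: "('p::finite \<times> 'q::finite \<Rightarrow> 'k) \<Rightarrow> ('p \<Rightarrow> 'q \<Rightarrow> 'a) \<Rightarrow> 'a" where
  "bilin T F = lin T (\<lambda>(p, q). F p q)"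

lemma bilin_eq_sum: "bilin T F = (\<Sum>p\<in>UNIV. \<Sum>q\<in>UNIV. \<phi> (T (p, q)) * F p q)"
  by (simp add: bilin_def lin_def sum_UNIV_prod)

lemma lin_bas [simp]: "lin (bas p) f = f p"
  by (simp add: lin_def phi_bas_mult)

lemma bilin_bas [simp]: "bilin (bas (p, q)) F = F p q"
  by (simp add: bilin_def)

lemma mult_lin: "a * lin v f = lin v (\<lambda>p. a * f p)"
  by (simp add: lin_def sum_distrib_left phi_left_commute)

lemma lin_mult: "lin v f * a = lin v (\<lambda>p. f p * a)"
  by (simp add: lin_def sum_distrib_right mult.assoc)

lemma mult_bilin: "a * bilin T F = bilin T (\<lambda>p q. a * F p q)"
  by (simp add: bilin_def mult_lin split_def)

lemma bilin_mult: "bilin T F * a = bilin T (\<lambda>p q. F p q * a)"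
  by (simp add: bilin_def lin_mult split_def)

lemma lin_sum: "lin v (\<lambda>p. \<Sum>s\<in>S. f s p) = (\<Sum>s\<in>S. lin v (f s))"
  unfolding lin_def sum_distrib_left by (rule sum.swap)

lemma bilin_sum: "bilin T (\<lambda>p q. \<Sum>s\<in>S. F s p q) = (\<Sum>s\<in>S. bilin T (F s))"
  by (simp add: bilin_def split_def lin_sum)

lemma lin_lin_commute: "lin v (\<lambda>p. lin w (\<lambda>q. F p q)) = lin w (\<lambda>q. lin v (\<lambda>p. F p q))"
  unfolding lin_def sum_distrib_left by (subst sum.swap) (intro sum.cong refl phi_left_commute)

lemma bilin_lin_commute: "bilin T (\<lambda>p q. lin w (\<lambda>r. F p q r)) = lin w (\<lambda>r. bilin T (\<lambda>p q. F p q r))"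
  using lin_lin_commute [of T w "\<lambda>z. F (fst z) (snd z)"] by (simp add: bilin_def split_def)

lemma bilin_bilin_commute:
  "bilin T (\<lambda>p q. bilin U (\<lambda>r s. F p q r s)) = bilin U (\<lambda>r s. bilin T (\<lambda>p q. F p q r s))"
  using bilin_lin_commute [of T U "\<lambda>p q z. F p q (fst z) (snd z)"]
  by (simp add: bilin_def split_def)

lemma bilin_bilin_right:
  "bilin T (\<lambda>p v. bilin (D v) (\<lambda>q r. F p q r))
    = (\<Sum>p\<in>UNIV. \<Sum>q\<in>UNIV. \<Sum>r\<in>UNIV. \<phi> (\<Sum>v\<in>UNIV. T (p, v) * D v (q, r)) * F p q r)"
proof -
  have rotate: "(\<Sum>v\<in>UNIV. \<Sum>q\<in>UNIV. \<Sum>r\<in>UNIV. G v q r) = (\<Sum>q\<in>UNIV. \<Sum>r\<in>UNIV. \<Sum>v\<in>UNIV. G v q r)"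
    for G :: "_ \<Rightarrow> _ \<Rightarrow> _ \<Rightarrow> 'a"
    by (subst sum.swap) (intro sum.cong refl sum.swap)
  show ?thesis
    unfolding bilin_eq_sum phi_sum phi_mult sum_distrib_left sum_distrib_right mult.assoc
    by (rule sum.cong [OF refl], rule rotate)
qed

lemma bilin_bilin_left:
  "bilin T (\<lambda>u r. bilin (D u) (\<lambda>p q. F p q r))
    = (\<Sum>p\<in>UNIV. \<Sum>q\<in>UNIV. \<Sum>r\<in>UNIV. \<phi> (\<Sum>u\<in>UNIV. T (u, r) * D u (p, q)) * F p q r)"
proof -
  have "(\<Sum>u\<in>UNIV. \<Sum>r\<in>UNIV. \<Sum>p\<in>UNIV. \<Sum>q\<in>UNIV. G u r p q)
      = (\<Sum>p\<in>UNIV. \<Sum>q\<in>UNIV. \<Sum>r\<in>UNIV. \<Sum>u\<in>UNIV. G u r p q)" for G :: "_ \<Rightarrow> _ \<Rightarrow> _ \<Rightarrow> _ \<Rightarrow> 'a"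
    unfolding sum.cartesian_product
    by (rule sum.reindex_bij_witness [of _ "\<lambda>(p, q, r, u). (u, r, p, q)"
        "\<lambda>(u, r, p, q). (p, q, r, u)"]) auto
  then show ?thesis
    by (simp add: bilin_eq_sum phi_sum phi_mult sum_distrib_left sum_distrib_right mult.assoc)
qed

end

text \<open>Coordinate vectors form an algebra under the pointwise operations, so Sweedler sums of vectors
  are the special case of the constant functions as scalars.\<close>

interpretation vec: kalgebra "\<lambda>(c::'k::field) (_::'q). c"
  by unfold_locales (auto simp: kalg_def fun_eq_iff)

interpretation scal: kalgebra "\<lambda>c::'k::field. c"
  by unfold_locales (auto simp: kalg_def)

abbreviation (input) lcomp :: "('q::finite \<Rightarrow> 'r \<Rightarrow> 'k::field) \<Rightarrow> ('p \<Rightarrow> 'q \<Rightarrow> 'k) \<Rightarrow> 'p \<Rightarrow> 'r \<Rightarrow> 'k"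
  (infixl "\<circ>\<^sub>k" 55) where
  "g \<circ>\<^sub>k f \<equiv> \<lambda>p. vec.lin (f p) g"

definition tensor :: "('p \<Rightarrow> 'k::field) \<Rightarrow> ('q \<Rightarrow> 'k) \<Rightarrow> 'p \<times> 'q \<Rightarrow> 'k" where
  "tensor v w = (\<lambda>(p, q). v p * w q)"

lemma vec_lin_apply: "vec.lin v M q = (\<Sum>p\<in>UNIV. v p * M p q)"
  by (simp add: vec.lin_def)

lemma vec_lin_bas [simp]: "vec.lin v bas = v"
  by (simp add: fun_eq_iff vec_lin_apply)

context kalgebra
begin

lemma lin_vec_lin: "lin (vec.lin v M) f = lin v (\<lambda>p. lin (M p) f)"
proof -
  have "(\<Sum>q\<in>UNIV. \<Sum>p\<in>UNIV. \<phi> (v p * M p q) * f q) = (\<Sum>p\<in>UNIV. \<Sum>q\<in>UNIV. \<phi> (v p * M p q) * f q)"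
    by (rule sum.swap)
  then show ?thesis
    by (simp add: lin_def vec_lin_apply phi_sum phi_mult sum_distrib_left sum_distrib_right
        mult.assoc)
qed

lemma bilin_vec_lin: "bilin (vec.lin v M) F = lin v (\<lambda>p. bilin (M p) F)"
  by (simp add: bilin_def lin_vec_lin)

lemma lin_vec_bilin: "lin (vec.bilin T M) f = bilin T (\<lambda>p q. lin (M p q) f)"
  by (simp add: bilin_def vec.bilin_def lin_vec_lin split_def)

lemma bilin_vec_bilin: "bilin (vec.bilin T M) F = bilin T (\<lambda>p q. bilin (M p q) F)"
  by (simp add: bilin_def vec.bilin_def lin_vec_lin split_def)

lemma lin_tensor: "lin (tensor v w) f = lin v (\<lambda>p. lin w (\<lambda>q. f (p, q)))"
  by (simp add: lin_def tensor_def sum_UNIV_prod phi_mult sum_distrib_left mult.assoc)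

lemma bilin_tensor: "bilin (tensor v w) F = lin v (\<lambda>p. lin w (F p))"
  by (simp add: bilin_def lin_tensor)

lemma lin_scale: "lin ((\<lambda>_. c) * v) f = \<phi> c * lin v f"
  by (simp add: lin_def phi_mult sum_distrib_left mult.assoc)

lemmas lin_bind = lin_vec_lin bilin_vec_lin lin_vec_bilin bilin_vec_bilin lin_tensor bilin_tensor

end

lemma tensor_vec_lin_left: "tensor (vec.lin v M) w = vec.lin v (\<lambda>i. tensor (M i) w)"
  and tensor_vec_lin_right: "tensor w (vec.lin v M) = vec.lin v (\<lambda>i. tensor w (M i))"
  by (auto simp: fun_eq_iff tensor_def vec_lin_apply sum_distrib_left sum_distrib_right mult_ac)

lemma tensor_vec_lin: "tensor (vec.lin v M) (vec.lin w N)
    = vec.lin v (\<lambda>i. vec.lin w (\<lambda>j. tensor (M i) (N j)))"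
  unfolding tensor_vec_lin_left by (simp only: tensor_vec_lin_right)

lemma tensor_vec_bilin:
  "tensor (vec.bilin T M) (vec.bilin U N)
      = vec.bilin T (\<lambda>a b. vec.bilin U (\<lambda>a' b'. tensor (M a b) (N a' b')))"
  by (simp add: vec.bilin_def tensor_vec_lin split_def)

lemma tensor_scale_left: "tensor ((\<lambda>_. c) * v) w = (\<lambda>_. c) * tensor v w"
  and tensor_scale_right: "tensor w ((\<lambda>_. c) * v) = (\<lambda>_. c) * tensor w v"
  by (auto simp: fun_eq_iff tensor_def)

lemma tensor_bas: "tensor (bas i) (bas j) = bas (i, j)"
  by (auto simp: fun_eq_iff tensor_def bas_def)

section \<open>Cocommutative coalgebras and their morphisms\<close>

definition cocomm_coalgebra :: "('c::finite \<Rightarrow> 'c \<times> 'c \<Rightarrow> 'k::field) \<Rightarrow> ('c \<Rightarrow> 'k) \<Rightarrow> bool" where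
  "cocomm_coalgebra d e \<longleftrightarrow>
     (\<forall>x p q r. (\<Sum>u\<in>UNIV. d x (u, r) * d u (p, q)) = (\<Sum>v\<in>UNIV. d x (p, v) * d v (q, r))) \<and>
     (\<forall>x j. (\<Sum>i\<in>UNIV. d x (i, j) * e i) = bas x j) \<and>
     (\<forall>x i j. d x (i, j) = d x (j, i))"

lemma cocomm_coalgebra_coassoc:
    "cocomm_coalgebra d e \<Longrightarrow>
      (\<Sum>u\<in>UNIV. d x (u, r) * d u (p, q)) = (\<Sum>v\<in>UNIV. d x (p, v) * d v (q, r))"
  and cocomm_coalgebra_counit: "cocomm_coalgebra d e \<Longrightarrow> (\<Sum>i\<in>UNIV. d x (i, j) * e i) = bas x j"
  and cocomm_coalgebra_cocomm: "cocomm_coalgebra d e \<Longrightarrow> d x (i, j) = d x (j, i)"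
  unfolding cocomm_coalgebra_def by blast+

definition tensor_comult :: "('c \<Rightarrow> 'c \<times> 'c \<Rightarrow> 'k::field) \<Rightarrow> ('i \<Rightarrow> 'i \<times> 'i \<Rightarrow> 'k)
    \<Rightarrow> 'c \<times> 'i \<Rightarrow> ('c \<times> 'i) \<times> ('c \<times> 'i) \<Rightarrow> 'k" where
  "tensor_comult d d' = (\<lambda>(x, y) ((a, a'), (b, b')). d x (a, b) * d' y (a', b'))"

definition tensor_counit :: "('c \<Rightarrow> 'k::field) \<Rightarrow> ('i \<Rightarrow> 'k) \<Rightarrow> 'c \<times> 'i \<Rightarrow> 'k" where
  "tensor_counit e e' = (\<lambda>(x, y). e x * e' y)"

lemma cocomm_coalgebra_tensor:
  assumes coalg: "cocomm_coalgebra d e" and coalg': "cocomm_coalgebra d' e'"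
  shows "cocomm_coalgebra (tensor_comult d d') (tensor_counit e e')"
  unfolding cocomm_coalgebra_def
proof (intro conjI allI)
  fix x j p q r :: "'a \<times> 'c"
  have "(\<Sum>u\<in>UNIV. tensor_comult d d' x (u, r) * tensor_comult d d' u (p, q))
      = (\<Sum>u\<in>UNIV. d (fst x) (u, fst r) * d u (fst p, fst q))
        * (\<Sum>u\<in>UNIV. d' (snd x) (u, snd r) * d' u (snd p, snd q))"
    unfolding sum_product by (simp add: sum_UNIV_prod tensor_comult_def split_def mult_ac)
  also have "\<dots> = (\<Sum>v\<in>UNIV. d (fst x) (fst p, v) * d v (fst q, fst r))
        * (\<Sum>v\<in>UNIV. d' (snd x) (snd p, v) * d' v (snd q, snd r))"
    by (simp only: cocomm_coalgebra_coassoc [OF coalg] cocomm_coalgebra_coassoc [OF coalg'])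
  also have "\<dots> = (\<Sum>v\<in>UNIV. tensor_comult d d' x (p, v) * tensor_comult d d' v (q, r))"
    unfolding sum_product by (simp add: sum_UNIV_prod tensor_comult_def split_def mult_ac)
  finally show "(\<Sum>u\<in>UNIV. tensor_comult d d' x (u, r) * tensor_comult d d' u (p, q))
      = (\<Sum>v\<in>UNIV. tensor_comult d d' x (p, v) * tensor_comult d d' v (q, r))" .
  have "(\<Sum>i\<in>UNIV. tensor_comult d d' x (i, j) * tensor_counit e e' i)
      = (\<Sum>i\<in>UNIV. d (fst x) (i, fst j) * e i) * (\<Sum>i\<in>UNIV. d' (snd x) (i, snd j) * e' i)"
    unfolding sum_product
    by (simp add: sum_UNIV_prod tensor_comult_def tensor_counit_def split_def mult_ac)
  also have "\<dots> = bas (fst x) (fst j) * bas (snd x) (snd j)"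
    by (simp only: cocomm_coalgebra_counit [OF coalg] cocomm_coalgebra_counit [OF coalg'])
  finally show "(\<Sum>i\<in>UNIV. tensor_comult d d' x (i, j) * tensor_counit e e' i) = bas x j"
    by (simp add: bas_Pair [of x "fst j" "snd j", simplified])
  show "tensor_comult d d' x (p, q) = tensor_comult d d' x (q, p)"
    using cocomm_coalgebra_cocomm [OF coalg, of _ "fst p"]
      cocomm_coalgebra_cocomm [OF coalg', of _ "snd p"]
    by (simp add: tensor_comult_def split_def)
qed

context kalgebra
begin

lemma bilin_coassoc:
  assumes "cocomm_coalgebra d e"
  shows "bilin (d x) (\<lambda>a r. bilin (d r) (\<lambda>b c. F a b c))
      = bilin (d x) (\<lambda>r c. bilin (d r) (\<lambda>a b. F a b c))"
  unfolding bilin_bilin_right bilin_bilin_left cocomm_coalgebra_coassoc [OF assms] ..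

lemma bilin_cocomm:
  assumes "cocomm_coalgebra d e"
  shows "bilin (d x) (\<lambda>a b. F a b) = bilin (d x) (\<lambda>a b. F b a)"
  unfolding bilin_eq_sum by (subst sum.swap) (simp add: cocomm_coalgebra_cocomm [OF assms])

lemma bilin_counit_left:
  assumes "cocomm_coalgebra d e"
  shows "bilin (d x) (\<lambda>a b. \<phi> (e a) * F b) = F x"
proof -
  have "bilin (d x) (\<lambda>a b. \<phi> (e a) * F b) = (\<Sum>b\<in>UNIV. \<phi> (\<Sum>a\<in>UNIV. d x (a, b) * e a) * F b)"
    unfolding bilin_eq_sum
    by (subst sum.swap) (simp add: phi_sum phi_mult sum_distrib_right mult.assoc)
  then show ?thesis
    by (simp add: cocomm_coalgebra_counit [OF assms] phi_bas_mult)
qed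

lemma bilin_counit_right:
  assumes "cocomm_coalgebra d e"
  shows "bilin (d x) (\<lambda>a b. \<phi> (e b) * F a) = F x"
  using bilin_counit_left [OF assms, of x F] bilin_cocomm [OF assms, of x "\<lambda>a b. \<phi> (e b) * F a"]
  by simp

lemma bilin_interchange:
  assumes coalg: "cocomm_coalgebra d e"
  shows "bilin (d x) (\<lambda>y z. bilin (d y) (\<lambda>a b. bilin (d z) (\<lambda>a' b'. F a b a' b')))
       = bilin (d x) (\<lambda>y z. bilin (d y) (\<lambda>a a'. bilin (d z) (\<lambda>b b'. F a b a' b')))"
proof -
  have right_nested: "bilin (d x) (\<lambda>y z. bilin (d y) (\<lambda>a b. bilin (d z) (\<lambda>a' b'. G a b a' b')))
      = bilin (d x) (\<lambda>a y. bilin (d y) (\<lambda>z b'. bilin (d z) (\<lambda>b a'. G a b a' b')))" for G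
    by (simp only: bilin_coassoc [OF coalg, symmetric, of x "\<lambda>a b z. bilin (d z) (G a b)"]
        bilin_coassoc [OF coalg, of _ "G _"])
  show ?thesis
    unfolding right_nested by (subst bilin_cocomm [OF coalg, of _ "\<lambda>b a'. F _ b a' _"]) (rule refl)
qed

lemma bilin_tensor_comult:
  "bilin (tensor_comult d d' (x, y)) F
      = bilin (d x) (\<lambda>a b. bilin (d' y) (\<lambda>a' b'. F (a, a') (b, b')))"
proof -
  have "bilin (tensor_comult d d' (x, y)) F = (\<Sum>a\<in>UNIV. \<Sum>a'\<in>UNIV. \<Sum>b\<in>UNIV. \<Sum>b'\<in>UNIV.
      \<phi> (d x (a, b)) * (\<phi> (d' y (a', b')) * F (a, a') (b, b')))"
    by (simp add: bilin_eq_sum sum_UNIV_prod tensor_comult_def phi_mult mult.assoc)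
  also have "\<dots> = (\<Sum>a\<in>UNIV. \<Sum>b\<in>UNIV. \<Sum>a'\<in>UNIV. \<Sum>b'\<in>UNIV.
      \<phi> (d x (a, b)) * (\<phi> (d' y (a', b')) * F (a, a') (b, b')))"
    by (rule sum.cong [OF refl], rule sum.swap)
  finally show ?thesis
    by (simp add: bilin_eq_sum sum_distrib_left)
qed

end

definition coalgebra_map :: "('c::finite \<Rightarrow> 'c \<times> 'c \<Rightarrow> 'k::field) \<Rightarrow> ('c \<Rightarrow> 'k)
    \<Rightarrow> ('i::finite \<Rightarrow> 'i \<times> 'i \<Rightarrow> 'k) \<Rightarrow> ('i \<Rightarrow> 'k) \<Rightarrow> ('c \<Rightarrow> 'i \<Rightarrow> 'k) \<Rightarrow> bool" where
  "coalgebra_map d e d' e' u \<longleftrightarrow>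
     (\<forall>x. vec.lin (u x) d' = vec.bilin (d x) (\<lambda>a b. tensor (u a) (u b))) \<and>
     (\<forall>x. scal.lin (u x) e' = e x)"

definition pair :: "('c::finite \<Rightarrow> 'c \<times> 'c \<Rightarrow> 'k::field) \<Rightarrow> ('c \<Rightarrow> 'i::finite \<Rightarrow> 'k)
    \<Rightarrow> ('c \<Rightarrow> 'j::finite \<Rightarrow> 'k) \<Rightarrow> 'c \<Rightarrow> 'i \<times> 'j \<Rightarrow> 'k" where
  "pair d u v x = vec.bilin (d x) (\<lambda>a b. tensor (u a) (v b))"

definition proj_left :: "('j \<Rightarrow> 'k::field) \<Rightarrow> 'i \<times> 'j \<Rightarrow> 'i \<Rightarrow> 'k" where
  "proj_left e' = (\<lambda>(x, y). (\<lambda>_. e' y) * bas x)"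

definition proj_right :: "('i \<Rightarrow> 'k::field) \<Rightarrow> 'i \<times> 'j \<Rightarrow> 'j \<Rightarrow> 'k" where
  "proj_right e = (\<lambda>(x, y). (\<lambda>_. e x) * bas y)"

context kalgebra
begin

lemma lin_pair: "lin (pair d u v x) F
    = bilin (d x) (\<lambda>a b. lin (u a) (\<lambda>i. lin (v b) (\<lambda>j. F (i, j))))"
  by (simp add: pair_def lin_bind)

lemma lin_proj_left: "lin (proj_left e' (x, y)) f = \<phi> (e' y) * f x"
  and lin_proj_right: "lin (proj_right e (x, y)) g = \<phi> (e x) * g y"
  by (simp_all add: proj_left_def proj_right_def lin_scale)

lemma coalgebra_map_comult:
  assumes "coalgebra_map d e d' e' u"
  shows "lin (u x) (\<lambda>i. bilin (d' i) F) = bilin (d x) (\<lambda>a b. lin (u a) (\<lambda>i. lin (u b) (F i)))"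
proof -
  have "bilin (vec.lin (u x) d') F = bilin (vec.bilin (d x) (\<lambda>a b. tensor (u a) (u b))) F"
    using assms by (simp add: coalgebra_map_def)
  then show ?thesis by (simp add: lin_bind)
qed

lemma coalgebra_map_counit:
  assumes "coalgebra_map d e d' e' u"
  shows "lin (u x) (\<lambda>i. \<phi> (e' i) * a) = \<phi> (e x) * a"
proof -
  have "lin (u x) (\<lambda>i. \<phi> (e' i) * a) = \<phi> (scal.lin (u x) e') * a"
    by (simp add: lin_def scal.lin_def phi_sum phi_mult sum_distrib_right mult.assoc)
  then show ?thesis using assms by (simp add: coalgebra_map_def)
qed

end

lemma vec_bilin_bas: "vec.bilin T (\<lambda>p q. bas (p, q)) = T"
  by (simp add: vec.bilin_def)

lemma tensor_eq_lin: "tensor v w = vec.lin v (\<lambda>i. vec.lin w (\<lambda>j. bas (i, j)))"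
  by (simp add: tensor_vec_lin_left [of v bas, simplified]
      tensor_vec_lin_right [of _ w bas, simplified] tensor_bas) (rule vec.lin_lin_commute)

lemma tensor_tensor_eq_lin:
  "tensor (tensor u v) (tensor u' v')
    = vec.lin u (\<lambda>i. vec.lin u' (\<lambda>i'. vec.lin v (\<lambda>j. vec.lin v'
        (\<lambda>j'. tensor (bas (i, j)) (bas (i', j'))))))"
  unfolding tensor_eq_lin [of u] tensor_eq_lin [of u'] tensor_vec_lin_left
  by (subst vec.lin_lin_commute) (simp add: tensor_vec_lin_right vec.lin_lin_commute [of v u'])

lemma lin_tensor_comult:
  "vec.lin (tensor v w) (tensor_comult d d')
    = vec.bilin (vec.lin v d) (\<lambda>a b. vec.bilin (vec.lin w d')
        (\<lambda>a' b'. tensor (bas (a, a')) (bas (b, b'))))"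
proof -
  have "tensor_comult d d' (i, j)
      = vec.bilin (d i) (\<lambda>a b. vec.bilin (d' j) (\<lambda>a' b'. tensor (bas (a, a')) (bas (b, b'))))"
    for i j
    using vec.bilin_tensor_comult [of d d' i j "\<lambda>z w. bas (z, w)"]
    by (simp add: vec_bilin_bas tensor_bas)
  then show ?thesis
    by (simp add: vec.lin_bind vec.bilin_lin_commute) (rule vec.lin_lin_commute)
qed

lemma coalgebra_map_pair:
  assumes coalg: "cocomm_coalgebra d e"
    and u_map: "coalgebra_map d e d1 e1 u" and v_map: "coalgebra_map d e d2 e2 v"
  shows "coalgebra_map d e (tensor_comult d1 d2) (tensor_counit e1 e2) (pair d u v)"
  unfolding coalgebra_map_def
proof (intro conjI allI)
  fix x
  have "vec.lin (tensor (u y) (v z)) (tensor_comult d1 d2)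
      = vec.bilin (d y) (\<lambda>a b. vec.bilin (d z)
          (\<lambda>a' b'. tensor (tensor (u a) (v a')) (tensor (u b) (v b'))))" for y z
    using u_map v_map unfolding lin_tensor_comult coalgebra_map_def
    by (simp add: vec.lin_bind vec.bilin_lin_commute tensor_tensor_eq_lin)
  then have "vec.lin (pair d u v x) (tensor_comult d1 d2)
      = vec.bilin (d x) (\<lambda>y z. vec.bilin (d y) (\<lambda>a b.
          vec.bilin (d z) (\<lambda>a' b'. tensor (tensor (u a) (v a')) (tensor (u b) (v b')))))"
    by (simp add: pair_def vec.lin_vec_bilin)
  also have "\<dots> = vec.bilin (d x) (\<lambda>y z. vec.bilin (d y) (\<lambda>a a'.
      vec.bilin (d z) (\<lambda>b b'. tensor (tensor (u a) (v a')) (tensor (u b) (v b')))))"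
    by (rule vec.bilin_interchange [OF coalg])
  finally show "vec.lin (pair d u v x) (tensor_comult d1 d2)
      = vec.bilin (d x) (\<lambda>y z. tensor (pair d u v y) (pair d u v z))"
    by (simp add: pair_def tensor_vec_bilin)
  have "scal.lin (pair d u v x) (tensor_counit e1 e2) = scal.bilin (d x) (\<lambda>a b. e a * e b)"
    using u_map v_map by (simp add: scal.lin_pair tensor_counit_def coalgebra_map_def
        flip: scal.mult_lin scal.lin_mult)
  then show "scal.lin (pair d u v x) (tensor_counit e1 e2) = e x"
    by (simp add: scal.bilin_counit_left [OF coalg])
qed

lemma coalgebra_map_comp:
  assumes u_map: "coalgebra_map d e d1 e1 u" and v_map: "coalgebra_map d1 e1 d2 e2 v"
  shows "coalgebra_map d e d2 e2 (v \<circ>\<^sub>k u)"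
  unfolding coalgebra_map_def
proof (intro conjI allI)
  fix x
  have "vec.lin (vec.lin (u x) v) d2
      = vec.lin (u x) (\<lambda>i. vec.bilin (d1 i) (\<lambda>a b. tensor (v a) (v b)))"
    using v_map by (simp add: vec.lin_vec_lin coalgebra_map_def)
  also have "\<dots> = vec.bilin (d x) (\<lambda>a b. vec.lin (u a) (\<lambda>i. vec.lin (u b) (\<lambda>j. tensor (v i) (v j))))"
    by (rule vec.coalgebra_map_comult [OF u_map])
  finally show "vec.lin (vec.lin (u x) v) d2
      = vec.bilin (d x) (\<lambda>a b. tensor (vec.lin (u a) v) (vec.lin (u b) v))"
    by (simp add: tensor_vec_lin)
  show "scal.lin (vec.lin (u x) v) e2 = e x"
    using u_map v_map by (simp add: scal.lin_vec_lin coalgebra_map_def)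
qed

lemma coalgebra_map_bas: "coalgebra_map d e d e bas"
  by (simp add: coalgebra_map_def vec_bilin_bas tensor_bas)

lemma coalgebra_map_proj_left:
  assumes "cocomm_coalgebra d' e'"
  shows "coalgebra_map (tensor_comult d d') (tensor_counit e e') d e (proj_left e')"
  unfolding coalgebra_map_def
proof (intro conjI allI; clarify)
  fix x y
  have "vec.bilin (tensor_comult d d' (x, y)) (\<lambda>p q. tensor (proj_left e' p) (proj_left e' q))
      = vec.bilin (d x) (\<lambda>a b. vec.bilin (d' y) (\<lambda>a' b'. (\<lambda>_. e' a') * ((\<lambda>_. e' b') * bas (a, b))))"
    by (simp add: vec.bilin_tensor_comult proj_left_def tensor_scale_left tensor_scale_right
        tensor_bas)
  also have "\<dots> = (\<lambda>_. e' y) * d x"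
    by (simp add: vec.bilin_counit_left [OF assms, where F="\<lambda>b. (\<lambda>_. e' b) * _"] vec_bilin_bas
        flip: vec.mult_bilin)
  finally show "vec.lin (proj_left e' (x, y)) d
      = vec.bilin (tensor_comult d d' (x, y)) (\<lambda>p q. tensor (proj_left e' p) (proj_left e' q))"
    by (simp add: vec.lin_proj_left)
  show "scal.lin (proj_left e' (x, y)) e = tensor_counit e e' (x, y)"
    by (simp add: scal.lin_proj_left tensor_counit_def)
qed

lemma coalgebra_map_proj_right:
  assumes "cocomm_coalgebra d e"
  shows "coalgebra_map (tensor_comult d d') (tensor_counit e e') d' e' (proj_right e)"
  unfolding coalgebra_map_def
proof (intro conjI allI; clarify)
  fix x y
  have "vec.bilin (tensor_comult d d' (x, y)) (\<lambda>p q. tensor (proj_right e p) (proj_right e q))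
      = vec.bilin (d x) (\<lambda>a b. (\<lambda>_. e a) * ((\<lambda>_. e b) * d' y))"
    by (simp add: vec.bilin_tensor_comult proj_right_def tensor_scale_left tensor_scale_right
        tensor_bas vec_bilin_bas flip: vec.mult_bilin)
  also have "\<dots> = (\<lambda>_. e x) * d' y"
    by (rule vec.bilin_counit_left [OF assms])
  finally show "vec.lin (proj_right e (x, y)) d'
      = vec.bilin (tensor_comult d d' (x, y)) (\<lambda>p q. tensor (proj_right e p) (proj_right e q))"
    by (simp add: vec.lin_proj_right)
  show "scal.lin (proj_right e (x, y)) e' = tensor_counit e e' (x, y)"
    by (simp add: scal.lin_proj_right tensor_counit_def)
qed

lemma pair_proj:
  assumes coalg: "cocomm_coalgebra d e" and coalg': "cocomm_coalgebra d' e'"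
  shows "pair (tensor_comult d d') (proj_left e') (proj_right e) = bas"
proof (rule ext, clarify)
  fix x y
  have "pair (tensor_comult d d') (proj_left e') (proj_right e) (x, y)
      = vec.bilin (d x) (\<lambda>a b. vec.bilin (d' y) (\<lambda>a' b'. (\<lambda>_. e' a') * ((\<lambda>_. e b) * bas (a, b'))))"
    by (simp add: pair_def vec.bilin_tensor_comult proj_left_def proj_right_def tensor_scale_left
        tensor_scale_right tensor_bas)
  also have "\<dots> = vec.bilin (d x) (\<lambda>a b. (\<lambda>_. e b) * bas (a, y))"
    by (simp only: vec.bilin_counit_left [OF coalg'])
  also have "\<dots> = bas (x, y)"
    by (rule vec.bilin_counit_right [OF coalg])
  finally show "pair (tensor_comult d d') (proj_left e') (proj_right e) (x, y) = bas (x, y)" .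
qed

lemma pair_comp:
  assumes "coalgebra_map d' e' d e w"
  shows "vec.lin (w x) (pair d u v) = pair d' (u \<circ>\<^sub>k w) (v \<circ>\<^sub>k w) x"
proof -
  have "vec.lin (w x) (pair d u v)
      = vec.bilin (d' x) (\<lambda>a b. vec.lin (w a) (\<lambda>i. vec.lin (w b) (\<lambda>j. tensor (u i) (v j))))"
    unfolding pair_def by (rule vec.coalgebra_map_comult [OF assms])
  then show ?thesis
    by (simp add: pair_def tensor_vec_lin)
qed

section \<open>Convolution and the group of points\<close>

definition coord_algebra :: "('i::finite \<times> 'i \<Rightarrow> 'i \<Rightarrow> 'k::field) \<Rightarrow> ('i \<Rightarrow> 'k) \<Rightarrow> bool" where
  "coord_algebra m \<eta> \<longleftrightarrow>
     (\<forall>i j k. vec.lin (m (i, j)) (\<lambda>l. m (l, k)) = vec.lin (m (j, k)) (\<lambda>l. m (i, l))) \<and>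
     (\<forall>j. vec.lin \<eta> (\<lambda>i. m (i, j)) = bas j) \<and>
     (\<forall>j. vec.lin \<eta> (\<lambda>i. m (j, i)) = bas j)"

definition tensor_mult :: "('i \<times> 'i \<Rightarrow> 'i \<Rightarrow> 'k::field) \<Rightarrow> ('j \<times> 'j \<Rightarrow> 'j \<Rightarrow> 'k)
    \<Rightarrow> ('i \<times> 'j) \<times> ('i \<times> 'j) \<Rightarrow> 'i \<times> 'j \<Rightarrow> 'k" where
  "tensor_mult m m' = (\<lambda>((i, j), (i', j')). tensor (m (i, i')) (m' (j, j')))"

lemma coord_algebra_tensor:
  assumes "coord_algebra m \<eta>" "coord_algebra m' \<eta>'"
  shows "coord_algebra (tensor_mult m m') (tensor \<eta> \<eta>')"
  using assms
  by (simp add: coord_algebra_def tensor_mult_def split_paired_all vec.lin_tensor tensor_bas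
      flip: tensor_vec_lin)

definition vec_conv :: "('c::finite \<Rightarrow> 'c \<times> 'c \<Rightarrow> 'k::field) \<Rightarrow> ('i::finite \<times> 'i \<Rightarrow> 'i \<Rightarrow> 'k)
    \<Rightarrow> ('c \<Rightarrow> 'i \<Rightarrow> 'k) \<Rightarrow> ('c \<Rightarrow> 'i \<Rightarrow> 'k) \<Rightarrow> 'c \<Rightarrow> 'i \<Rightarrow> 'k" where
  "vec_conv d m u v = m \<circ>\<^sub>k pair d u v"

definition vec_conv_one :: "('c \<Rightarrow> 'k::field) \<Rightarrow> ('i \<Rightarrow> 'k) \<Rightarrow> 'c \<Rightarrow> 'i \<Rightarrow> 'k" where
  "vec_conv_one e \<eta> x = (\<lambda>_. e x) * \<eta>"

lemma vec_conv_apply: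
  "vec_conv d m u v x = vec.bilin (d x) (\<lambda>a b. vec.lin (u a) (\<lambda>i. vec.lin (v b) (\<lambda>j. m (i, j))))"
  by (simp add: vec_conv_def vec.lin_pair)

definition convolution_monoid :: "('c::finite \<Rightarrow> 'c \<times> 'c \<Rightarrow> 'k::field) \<Rightarrow> ('c \<Rightarrow> 'k)
    \<Rightarrow> ('i::finite \<times> 'i \<Rightarrow> 'i \<Rightarrow> 'k) \<Rightarrow> ('i \<Rightarrow> 'k) \<Rightarrow> ('c \<Rightarrow> 'i \<Rightarrow> 'k) monoid" where
  "convolution_monoid d e m \<eta> = \<lparr>carrier = UNIV, mult = vec_conv d m, one = vec_conv_one e \<eta>\<rparr>"

lemma vec_conv_assoc:
  assumes coalg: "cocomm_coalgebra d e" and algebra_m: "coord_algebra m \<eta>"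
  shows "vec_conv d m (vec_conv d m u v) w = vec_conv d m u (vec_conv d m v w)"
proof
  fix x
  let ?F = "\<lambda>a b c. vec.lin (u a) (\<lambda>i. vec.lin (v b)
      (\<lambda>j. vec.lin (w c) (\<lambda>k. vec.lin (m (i, j)) (\<lambda>l. m (l, k)))))"
  have "vec_conv d m (vec_conv d m u v) w x
      = vec.bilin (d x) (\<lambda>r c. vec.bilin (d r) (\<lambda>a b. ?F a b c))"
    by (simp add: vec_conv_apply vec.lin_bind vec.lin_lin_commute [of "m _" "w _"])
  also have "\<dots> = vec.bilin (d x) (\<lambda>a r. vec.bilin (d r) (\<lambda>b c. ?F a b c))"
    by (rule vec.bilin_coassoc [OF coalg, symmetric])
  also have "\<dots> = vec_conv d m u (vec_conv d m v w) x"
    using algebra_m by (simp add: vec_conv_apply vec.lin_bind coord_algebra_def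
        flip: vec.bilin_lin_commute)
  finally show "vec_conv d m (vec_conv d m u v) w x = vec_conv d m u (vec_conv d m v w) x" .
qed

lemma vec_conv_one_left:
  assumes "cocomm_coalgebra d e" "coord_algebra m \<eta>"
  shows "vec_conv d m (vec_conv_one e \<eta>) u = u"
proof
  fix x
  have "vec_conv d m (vec_conv_one e \<eta>) u x
      = vec.bilin (d x) (\<lambda>a b. (\<lambda>_. e a) * vec.lin (u b) (\<lambda>j. vec.lin \<eta> (\<lambda>i. m (i, j))))"
    by (simp add: vec_conv_apply vec_conv_one_def vec.lin_scale vec.lin_lin_commute [of \<eta>])
  then show "vec_conv d m (vec_conv_one e \<eta>) u x = u x"
    using assms by (simp add: coord_algebra_def vec.bilin_counit_left)
qed

lemma vec_conv_one_right:
  assumes "cocomm_coalgebra d e" "coord_algebra m \<eta>"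
  shows "vec_conv d m u (vec_conv_one e \<eta>) = u"
proof
  fix x
  have "vec_conv d m u (vec_conv_one e \<eta>) x
      = vec.bilin (d x) (\<lambda>a b. (\<lambda>_. e b) * vec.lin (u a) (\<lambda>i. vec.lin \<eta> (\<lambda>j. m (i, j))))"
    by (simp add: vec_conv_apply vec_conv_one_def vec.lin_scale flip: vec.mult_lin)
  then show "vec_conv d m u (vec_conv_one e \<eta>) x = u x"
    using assms by (simp add: coord_algebra_def vec.bilin_counit_right)
qed

lemma monoid_convolution:
  assumes "cocomm_coalgebra d e" "coord_algebra m \<eta>"
  shows "monoid (convolution_monoid d e m \<eta>)"
  using vec_conv_assoc [OF assms] vec_conv_one_left [OF assms] vec_conv_one_right [OF assms]
  by (intro monoidI) (simp_all add: convolution_monoid_def)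

lemma vec_conv_algebra_map:
  assumes "\<And>i j. vec.lin (m (i, j)) f = vec.lin (f i) (\<lambda>p. vec.lin (f j) (\<lambda>q. m' (p, q)))"
  shows "f \<circ>\<^sub>k vec_conv d m u v = vec_conv d m' (f \<circ>\<^sub>k u) (f \<circ>\<^sub>k v)"
proof
  fix x
  have "vec.lin (vec_conv d m u v x) f
      = vec.bilin (d x) (\<lambda>a b. vec.lin (u a) (\<lambda>i. vec.lin (v b)
          (\<lambda>j. vec.lin (f i) (\<lambda>p. vec.lin (f j) (\<lambda>q. m' (p, q))))))"
    by (simp add: vec_conv_apply vec.lin_bind assms)
  then show "vec.lin (vec_conv d m u v x) f = vec_conv d m' (f \<circ>\<^sub>k u) (f \<circ>\<^sub>k v) x"
    by (simp add: vec_conv_apply vec.lin_bind vec.lin_lin_commute [of "v _" "f _"])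
qed

lemma vec_conv_one_algebra_map: "vec.lin \<eta> f = \<eta>' \<Longrightarrow> f \<circ>\<^sub>k vec_conv_one e \<eta> = vec_conv_one e \<eta>'"
  by (simp add: fun_eq_iff vec_conv_one_def vec.lin_scale)

lemma vec_conv_comp:
  assumes "coalgebra_map d' e' d e w"
  shows "vec_conv d m u v \<circ>\<^sub>k w = vec_conv d' m (u \<circ>\<^sub>k w) (v \<circ>\<^sub>k w)"
  by (simp add: vec_conv_def pair_comp [OF assms] flip: vec.lin_vec_lin)

lemma vec_conv_one_comp:
  assumes "coalgebra_map d' e' d e w"
  shows "vec_conv_one e \<eta> \<circ>\<^sub>k w = vec_conv_one e' \<eta>"
  by (rule ext) (simp add: vec_conv_one_def [abs_def] vec.coalgebra_map_counit [OF assms])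

locale cocomm_hopf =
  fixes H :: "('i::finite, 'k::field) hopf_data"
  assumes is_hopf: "is_hopf H" and cocommutative: "cocommutative H"
begin

definition \<Delta> :: "'i \<Rightarrow> 'i \<times> 'i \<Rightarrow> 'k" where "\<Delta> i = cop H (bas i)"

definition \<epsilon> :: "'i \<Rightarrow> 'k" where "\<epsilon> i = eps H (bas i)"

definition \<mu> :: "'i \<times> 'i \<Rightarrow> 'i \<Rightarrow> 'k" where "\<mu> = (\<lambda>(i, j). hmul H (bas i) (bas j))"

definition antipode :: "'i \<Rightarrow> 'i \<Rightarrow> 'k" where "antipode i = ant H (bas i)"

lemma cop_eq_lin: "cop H x = vec.lin x \<Delta>"
proof -
  have "\<Delta> l (i, j) = hcom H l i j" for l i j
    by (simp add: \<Delta>_def cop_def)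
  then show ?thesis by (simp add: fun_eq_iff cop_def vec_lin_apply)
qed

lemma eps_eq_lin: "eps H x = scal.lin x \<epsilon>"
  by (simp add: eps_def \<epsilon>_def scal.lin_def)

lemma hmul_eq_lin: "hmul H x y = vec.lin x (\<lambda>i. vec.lin y (\<lambda>j. \<mu> (i, j)))"
proof -
  have "\<mu> (i, j) l = hmu H i j l" for i j l
    by (simp add: \<mu>_def hmul_def mult.assoc flip: sum_distrib_left)
  then show ?thesis by (simp add: fun_eq_iff hmul_def vec_lin_apply sum_distrib_left mult.assoc)
qed

lemma hmul_bas: "hmul H (bas i) (bas j) = \<mu> (i, j)"
  by (simp add: \<mu>_def)

lemma cocomm_coalgebra: "cocomm_coalgebra \<Delta> \<epsilon>"
  using is_hopf cocommutative
  unfolding cocomm_coalgebra_def is_hopf_def cocommutative_def \<Delta>_def \<epsilon>_def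
  by (auto simp: fun_eq_iff)

lemma coord_algebra: "coord_algebra \<mu> (hone H)"
proof -
  have "hmul H (hmul H (bas i) (bas j)) (bas k) = hmul H (bas i) (hmul H (bas j) (bas k))"
    "hmul H (hone H) (bas j) = bas j" "hmul H (bas j) (hone H) = bas j" for i j k
    using is_hopf by (simp_all add: is_hopf_def)
  then show ?thesis
    by (simp add: coord_algebra_def hmul_eq_lin)
qed

lemma comult_mult:
  "vec.lin (\<mu> (i, j)) \<Delta>
    = vec.bilin (\<Delta> i) (\<lambda>a b. vec.bilin (\<Delta> j) (\<lambda>a' b'. tensor (\<mu> (a, a')) (\<mu> (b, b'))))"
proof -
  let ?rhs = "vec.bilin (\<Delta> i) (\<lambda>a b. vec.bilin (\<Delta> j) (\<lambda>a' b'. tensor (\<mu> (a, a')) (\<mu> (b, b'))))"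
  have "cop H (hmul H (bas i) (bas j)) (p, q) = ?rhs (p, q)" for p q
  proof -
    have "cop H (hmul H (bas i) (bas j)) (p, q) = (\<Sum>a\<in>UNIV. \<Sum>b\<in>UNIV. \<Sum>a'\<in>UNIV. \<Sum>b'\<in>UNIV.
        \<Delta> i (a, b) * \<Delta> j (a', b') * \<mu> (a, a') p * \<mu> (b, b') q)"
      using is_hopf by (simp add: is_hopf_def \<Delta>_def flip: hmul_bas)
    then show ?thesis
      by (simp add: vec.bilin_eq_sum tensor_def sum_distrib_left mult.assoc)
  qed
  then show ?thesis
    by (simp add: fun_eq_iff cop_eq_lin hmul_bas)
qed

lemma comult_one: "vec.lin (hone H) \<Delta> = tensor (hone H) (hone H)"
  using is_hopf by (simp add: fun_eq_iff is_hopf_def tensor_def flip: cop_eq_lin)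

lemma counit_mult: "scal.lin (\<mu> (i, j)) \<epsilon> = \<epsilon> i * \<epsilon> j"
  using is_hopf by (simp add: is_hopf_def \<epsilon>_def flip: eps_eq_lin hmul_bas)

lemma counit_one: "scal.lin (hone H) \<epsilon> = 1"
  using is_hopf by (simp add: is_hopf_def flip: eps_eq_lin)

lemma vec_conv_antipode_left: "vec_conv \<Delta> \<mu> antipode bas = vec_conv_one \<epsilon> (hone H)"
  and vec_conv_antipode_right: "vec_conv \<Delta> \<mu> bas antipode = vec_conv_one \<epsilon> (hone H)"
proof -
  have law_left: "(\<Sum>i\<in>UNIV. \<Sum>j\<in>UNIV. \<Delta> x (i, j) * hmul H (antipode i) (bas j) l) = \<epsilon> x * hone H l"
    and law_right: "(\<Sum>i\<in>UNIV. \<Sum>j\<in>UNIV. \<Delta> x (i, j) * hmul H (bas i) (antipode j) l)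
        = \<epsilon> x * hone H l" for x l
    using is_hopf unfolding is_hopf_def \<Delta>_def \<epsilon>_def antipode_def by meson+
  show "vec_conv \<Delta> \<mu> antipode bas = vec_conv_one \<epsilon> (hone H)"
      "vec_conv \<Delta> \<mu> bas antipode = vec_conv_one \<epsilon> (hone H)"
    using law_left law_right
    by (simp_all add: fun_eq_iff vec_conv_apply vec_conv_one_def vec.bilin_eq_sum hmul_eq_lin)
qed

lemma coalgebra_map_mult: "coalgebra_map (tensor_comult \<Delta> \<Delta>) (tensor_counit \<epsilon> \<epsilon>) \<Delta> \<epsilon> \<mu>"
  by (simp add: coalgebra_map_def split_paired_all vec.bilin_tensor_comult comult_mult counit_mult
      tensor_counit_def)

lemma coalgebra_map_one:
  assumes "cocomm_coalgebra d e"
  shows "coalgebra_map d e \<Delta> \<epsilon> (vec_conv_one e (hone H))"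
  by (simp add: coalgebra_map_def vec_conv_one_def vec.lin_scale scal.lin_scale comult_one
      counit_one tensor_scale_left tensor_scale_right vec.bilin_counit_right [OF assms]
      del: times_fun_apply)

lemma coalgebra_map_vec_conv:
  assumes "cocomm_coalgebra d e" "coalgebra_map d e \<Delta> \<epsilon> u" "coalgebra_map d e \<Delta> \<epsilon> v"
  shows "coalgebra_map d e \<Delta> \<epsilon> (vec_conv d \<mu> u v)"
  unfolding vec_conv_def
  by (rule coalgebra_map_comp [OF coalgebra_map_pair [OF assms] coalgebra_map_mult])

text \<open>Both sides of \<open>\<Delta>(S(x)) = S(x\<^sub>1) \<otimes> S(x\<^sub>2)\<close> are convolution inverses of \<open>\<Delta>\<close> in \<open>Hom(H, H \<otimes> H)\<close>.\<close>

lemma comult_antipode: "\<Delta> \<circ>\<^sub>k antipode = pair \<Delta> antipode antipode"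
proof -
  let ?M = "convolution_monoid \<Delta> \<epsilon> (tensor_mult \<mu> \<mu>) (tensor (hone H) (hone H))"
  let ?one = "vec_conv_one \<epsilon> (tensor (hone H) (hone H))"
  interpret M: monoid ?M
    by (intro monoid_convolution cocomm_coalgebra coord_algebra_tensor coord_algebra)
  have "vec_conv \<Delta> (tensor_mult \<mu> \<mu>) (\<Delta> \<circ>\<^sub>k antipode) (\<Delta> \<circ>\<^sub>k bas) = \<Delta> \<circ>\<^sub>k vec_conv \<Delta> \<mu> antipode bas"
    by (rule vec_conv_algebra_map [symmetric])
       (simp add: comult_mult tensor_mult_def vec.bilin_def split_def)
  then have left: "vec_conv \<Delta> (tensor_mult \<mu> \<mu>) (\<Delta> \<circ>\<^sub>k antipode) \<Delta> = ?one"
    by (simp add: vec_conv_antipode_left vec_conv_one_algebra_map [OF comult_one])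
  have right: "vec_conv \<Delta> (tensor_mult \<mu> \<mu>) \<Delta> (pair \<Delta> antipode antipode) = ?one"
  proof
    fix x
    have "vec_conv \<Delta> (tensor_mult \<mu> \<mu>) \<Delta> (pair \<Delta> antipode antipode) x
        = vec.bilin (\<Delta> x) (\<lambda>y z. vec.bilin (\<Delta> y) (\<lambda>a b. vec.bilin (\<Delta> z) (\<lambda>a' b'.
            tensor (vec.lin (antipode a') (\<lambda>i. \<mu> (a, i))) (vec.lin (antipode b') (\<lambda>i. \<mu> (b, i))))))"
      by (simp add: vec_conv_apply vec.lin_pair tensor_mult_def tensor_vec_lin vec.bilin_def
          split_def)
    also have "\<dots> = vec.bilin (\<Delta> x) (\<lambda>y z. vec.bilin (\<Delta> y) (\<lambda>a a'. vec.bilin (\<Delta> z) (\<lambda>b b'.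
            tensor (vec.lin (antipode a') (\<lambda>i. \<mu> (a, i))) (vec.lin (antipode b') (\<lambda>i. \<mu> (b, i))))))"
      by (rule vec.bilin_interchange [OF cocomm_coalgebra])
    also have "\<dots> = vec.bilin (\<Delta> x)
        (\<lambda>y z. tensor (vec_conv \<Delta> \<mu> bas antipode y) (vec_conv \<Delta> \<mu> bas antipode z))"
      by (simp add: vec_conv_apply tensor_vec_bilin)
    also have "\<dots> = ?one x"
      by (simp add: vec_conv_antipode_right vec_conv_one_def tensor_scale_left tensor_scale_right
          vec.bilin_counit_right [OF cocomm_coalgebra] del: times_fun_apply)
    finally show "vec_conv \<Delta> (tensor_mult \<mu> \<mu>) \<Delta> (pair \<Delta> antipode antipode) x = ?one x" .
  qed
  show ?thesis
    using M.inv_unique [of _ \<Delta>] left right by (simp add: convolution_monoid_def)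
qed

lemma coalgebra_map_antipode: "coalgebra_map \<Delta> \<epsilon> \<Delta> \<epsilon> antipode"
  unfolding coalgebra_map_def
proof (intro conjI allI)
  fix x
  show "vec.lin (antipode x) \<Delta> = vec.bilin (\<Delta> x) (\<lambda>a b. tensor (antipode a) (antipode b))"
    using fun_cong [OF comult_antipode, of x] by (simp add: pair_def)
  have "scal.lin (antipode x) \<epsilon> = scal.bilin (\<Delta> x) (\<lambda>a b. \<epsilon> a * scal.lin (antipode b) \<epsilon>)"
    by (rule scal.bilin_counit_left [OF cocomm_coalgebra, symmetric])
  also have "\<dots> = scal.lin (vec_conv \<Delta> \<mu> bas antipode x) \<epsilon>"
    by (simp add: vec_conv_apply scal.lin_bind counit_mult scal.mult_lin)
  finally show "scal.lin (antipode x) \<epsilon> = \<epsilon> x"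
    by (simp add: vec_conv_antipode_right vec_conv_one_def scal.lin_scale counit_one)
qed

definition point_group :: "('c::finite \<Rightarrow> 'c \<times> 'c \<Rightarrow> 'k) \<Rightarrow> ('c \<Rightarrow> 'k) \<Rightarrow> ('c \<Rightarrow> 'i \<Rightarrow> 'k) monoid" where
  "point_group d e =
     \<lparr>carrier = {u. coalgebra_map d e \<Delta> \<epsilon> u}, mult = vec_conv d \<mu>, one = vec_conv_one e (hone H)\<rparr>"

lemma point_group_simps [simp]:
  "u \<in> carrier (point_group d e) \<longleftrightarrow> coalgebra_map d e \<Delta> \<epsilon> u"
  "u \<otimes>\<^bsub>point_group d e\<^esub> v = vec_conv d \<mu> u v"
  "\<one>\<^bsub>point_group d e\<^esub> = vec_conv_one e (hone H)"
  by (simp_all add: point_group_def)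

lemma vec_conv_antipode_point:
  assumes u_map: "coalgebra_map d e \<Delta> \<epsilon> u"
  shows "vec_conv d \<mu> (antipode \<circ>\<^sub>k u) u = vec_conv_one e (hone H)"
proof -
  have "vec_conv d \<mu> (antipode \<circ>\<^sub>k u) (bas \<circ>\<^sub>k u) = vec_conv \<Delta> \<mu> antipode bas \<circ>\<^sub>k u"
    by (rule vec_conv_comp [OF u_map, symmetric])
  then show ?thesis
    by (simp add: vec_conv_antipode_left vec_conv_one_comp [OF u_map])
qed

lemma group_point_group:
  assumes coalg: "cocomm_coalgebra d e"
  shows "group (point_group d e)"
proof (rule groupI)
  fix u assume "u \<in> carrier (point_group d e)"
  then have u_map: "coalgebra_map d e \<Delta> \<epsilon> u" by simp
  show "\<exists>v\<in>carrier (point_group d e). v \<otimes>\<^bsub>point_group d e\<^esub> u = \<one>\<^bsub>point_group d e\<^esub>"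
    using vec_conv_antipode_point [OF u_map] coalgebra_map_comp [OF u_map coalgebra_map_antipode]
    by (intro bexI [of _ "antipode \<circ>\<^sub>k u"]) simp_all
qed (simp_all add: coalgebra_map_vec_conv [OF coalg] coalgebra_map_one [OF coalg]
      vec_conv_assoc [OF coalg coord_algebra] vec_conv_one_left [OF coalg coord_algebra])

lemma inv_point:
  assumes "cocomm_coalgebra d e" and u_map: "coalgebra_map d e \<Delta> \<epsilon> u"
  shows "inv\<^bsub>point_group d e\<^esub> u = antipode \<circ>\<^sub>k u"
proof -
  interpret group "point_group d e" by (rule group_point_group) fact
  show ?thesis
    using vec_conv_antipode_point [OF u_map] u_map
        coalgebra_map_comp [OF u_map coalgebra_map_antipode]
    by (intro inv_equality) simp_all
qed

end

section \<open>Symmetric twisted partial actions of groups\<close>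

locale twisted_partial_group_action = group G + unital: Groups.monoid star unit
  for G :: "('g, 'm) monoid_scheme" (structure)
    and star :: "'r \<Rightarrow> 'r \<Rightarrow> 'r" (infixl "\<star>" 70) and unit :: 'r +
  fixes act :: "'g \<Rightarrow> 'r \<Rightarrow> 'r" (infixr "\<rhd>" 67) and \<omega> \<omega>' :: "'g \<Rightarrow> 'g \<Rightarrow> 'r"
  assumes act_one: "\<one> \<rhd> f = f"
    and act_star: "u \<in> carrier G \<Longrightarrow> u \<rhd> (f \<star> g) = (u \<rhd> f) \<star> (u \<rhd> g)"
    and act_unit_central: "u \<in> carrier G \<Longrightarrow> (u \<rhd> unit) \<star> f = f \<star> (u \<rhd> unit)"
    and act_act_unit: "\<lbrakk>u \<in> carrier G; v \<in> carrier G\<rbrakk>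
      \<Longrightarrow> u \<rhd> v \<rhd> unit = (u \<rhd> unit) \<star> (u \<otimes> v \<rhd> unit)"
    and act_act: "\<lbrakk>u \<in> carrier G; v \<in> carrier G\<rbrakk>
      \<Longrightarrow> (u \<rhd> v \<rhd> f) \<star> \<omega> u v = \<omega> u v \<star> (u \<otimes> v \<rhd> f)"
    and cocycle: "\<lbrakk>u \<in> carrier G; v \<in> carrier G; w \<in> carrier G\<rbrakk>
      \<Longrightarrow> (u \<rhd> \<omega> v w) \<star> \<omega> u (v \<otimes> w) = \<omega> u v \<star> \<omega> (u \<otimes> v) w"
    and cocycle_one: "u \<in> carrier G \<Longrightarrow> \<omega> \<one> u = u \<rhd> unit" "u \<in> carrier G \<Longrightarrow> \<omega> u \<one> = u \<rhd> unit"
    and cocycle_inverse: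
      "\<lbrakk>u \<in> carrier G; v \<in> carrier G\<rbrakk> \<Longrightarrow> \<omega> u v \<star> \<omega>' u v = (u \<rhd> unit) \<star> (u \<otimes> v \<rhd> unit)"
      "\<lbrakk>u \<in> carrier G; v \<in> carrier G\<rbrakk> \<Longrightarrow> \<omega>' u v \<star> \<omega> u v = (u \<rhd> unit) \<star> (u \<otimes> v \<rhd> unit)"
begin

definition dom_unit :: "'g \<Rightarrow> 'r" where
  "dom_unit u = u \<rhd> unit"

lemma dom_unit_central: "u \<in> carrier G \<Longrightarrow> dom_unit u \<star> f = f \<star> dom_unit u"
  by (simp add: dom_unit_def act_unit_central)

lemma dom_unit_one: "dom_unit \<one> = unit"
  by (simp add: dom_unit_def act_one)

lemma act_dom_unit:
  "\<lbrakk>u \<in> carrier G; v \<in> carrier G\<rbrakk> \<Longrightarrow> u \<rhd> dom_unit v = dom_unit u \<star> dom_unit (u \<otimes> v)"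
  by (simp add: dom_unit_def act_act_unit)

lemma act_star_dom_unit: "u \<in> carrier G \<Longrightarrow> (u \<rhd> f) \<star> dom_unit u = u \<rhd> f"
  using act_star [of u f unit] by (simp add: dom_unit_def)

lemma dom_unit_star_act: "u \<in> carrier G \<Longrightarrow> dom_unit u \<star> (u \<rhd> f) = u \<rhd> f"
  by (simp add: dom_unit_central act_star_dom_unit)

lemma dom_unit_idem: "u \<in> carrier G \<Longrightarrow> dom_unit u \<star> dom_unit u = dom_unit u"
  using act_star_dom_unit [of u unit] by (simp add: dom_unit_def)

lemma act_cocycle_inv:
  assumes "w \<in> carrier G"
  shows "w \<rhd> \<omega> (inv w) w = \<omega> w (inv w) \<star> dom_unit w"
  using cocycle [of w "inv w" w] assms
  by (simp add: cocycle_one act_star_dom_unit flip: dom_unit_def)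

lemma act_cocycle_inverse_inv:
  assumes w_carrier: "w \<in> carrier G"
  shows "(w \<rhd> \<omega>' (inv w) w) \<star> \<omega> w (inv w) = dom_unit w"
proof -
  have "(w \<rhd> \<omega>' (inv w) w) \<star> \<omega> w (inv w) = (w \<rhd> \<omega>' (inv w) w) \<star> dom_unit w \<star> \<omega> w (inv w)"
    by (simp add: act_star_dom_unit w_carrier)
  also have "\<dots> = w \<rhd> (\<omega>' (inv w) w \<star> \<omega> (inv w) w)"
    by (simp add: act_star act_cocycle_inv dom_unit_central unital.assoc w_carrier)
  also have "\<dots> = w \<rhd> dom_unit (inv w)"
    by (simp add: cocycle_inverse dom_unit_one w_carrier flip: dom_unit_def)
  also have "\<dots> = dom_unit w"
    by (simp add: act_dom_unit dom_unit_one w_carrier)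
  finally show ?thesis .
qed

text \<open>In the crossed product, \<open>(f, u)\<close> stands for \<open>f \<gamma>(u)\<close>, the partial inverse of \<open>\<gamma>(w)\<close> is
  \<open>\<gamma>'(w) = inv_coeff w \<gamma>(w\<^sup>-\<^sup>1)\<close>, and \<open>conj w f\<close> is \<open>\<gamma>'(w) f \<gamma>(w)\<close>.\<close>

definition crossed_mult :: "'r \<times> 'g \<Rightarrow> 'r \<times> 'g \<Rightarrow> 'r \<times> 'g" (infixl "\<bullet>" 70) where
  "p \<bullet> q = (fst p \<star> (snd p \<rhd> fst q) \<star> \<omega> (snd p) (snd q), snd p \<otimes> snd q)"

definition inv_coeff :: "'g \<Rightarrow> 'r" where
  "inv_coeff w = \<omega>' (inv w) w \<star> dom_unit (inv w)"

definition conj :: "'g \<Rightarrow> 'r \<Rightarrow> 'r" where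
  "conj w f = \<omega>' (inv w) w \<star> (inv w \<rhd> f) \<star> \<omega> (inv w) w"

lemma inv_coeff_star_dom_unit: "w \<in> carrier G \<Longrightarrow> inv_coeff w \<star> dom_unit (inv w) = inv_coeff w"
  by (simp add: inv_coeff_def unital.assoc dom_unit_idem)

lemma act_conj:
  assumes w_carrier: "w \<in> carrier G"
  shows "w \<rhd> conj w f = f \<star> dom_unit w"
proof -
  have "w \<rhd> conj w f = (w \<rhd> \<omega>' (inv w) w) \<star> ((w \<rhd> inv w \<rhd> f) \<star> \<omega> w (inv w)) \<star> dom_unit w"
    by (simp add: conj_def act_star act_cocycle_inv unital.assoc w_carrier)
  also have "\<dots> = (w \<rhd> \<omega>' (inv w) w) \<star> \<omega> w (inv w) \<star> (f \<star> dom_unit w)"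
    by (simp add: act_act act_one unital.assoc w_carrier)
  also have "\<dots> = f \<star> (dom_unit w \<star> dom_unit w)"
    by (simp add: act_cocycle_inverse_inv dom_unit_central [of w "f \<star> _"] unital.assoc w_carrier)
  finally show ?thesis
    by (simp add: dom_unit_idem w_carrier)
qed

lemma crossed_mult_central:
  assumes u_carrier: "u \<in> carrier G" and v_carrier: "v \<in> carrier G"
    and c_central: "\<And>f. c \<star> f = f \<star> c"
  shows "(f \<star> dom_unit u, u) \<bullet> (v \<rhd> c, v) = (u \<otimes> v \<rhd> (c \<star> conj (u \<otimes> v) (f \<star> \<omega> u v)), u \<otimes> v)"
proof -
  let ?w = "u \<otimes> v"
  have w_carrier: "?w \<in> carrier G" using u_carrier v_carrier by simp
  have "?w \<rhd> (c \<star> conj ?w (f \<star> \<omega> u v)) = f \<star> \<omega> u v \<star> (dom_unit ?w \<star> (?w \<rhd> c))"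
    by (simp add: c_central act_star [OF w_carrier] act_conj [OF w_carrier] unital.assoc)
  also have "\<dots> = f \<star> (\<omega> u v \<star> (?w \<rhd> c))"
    by (simp add: dom_unit_star_act w_carrier unital.assoc)
  also have "\<dots> = f \<star> (dom_unit u \<star> (u \<rhd> v \<rhd> c)) \<star> \<omega> u v"
    by (simp add: act_act dom_unit_star_act unital.assoc u_carrier v_carrier)
  finally show ?thesis
    by (simp add: crossed_mult_def unital.assoc)
qed

lemma inv_mult_cancel:
  assumes "u \<in> carrier G" "v \<in> carrier G"
  shows "inv (u \<otimes> v) \<otimes> u = inv v"
  using assms by (simp add: inv_mult_group m_assoc)

lemma conj_inv_coeff:
  assumes u_carrier: "u \<in> carrier G" and v_carrier: "v \<in> carrier G"
  shows "(conj (u \<otimes> v) (f \<star> \<omega> u v) \<star> inv_coeff v, inv v)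
    = (inv_coeff (u \<otimes> v), inv (u \<otimes> v)) \<bullet> (f \<star> dom_unit u, u)"
proof -
  let ?w = "u \<otimes> v" and ?v' = "inv v"
  let ?w' = "inv ?w"
  have w'_carrier: "?w' \<in> carrier G" and v'_carrier: "?v' \<in> carrier G"
    using u_carrier v_carrier by simp_all
  note cancel = inv_mult_cancel [OF u_carrier v_carrier]
  have "conj ?w (f \<star> \<omega> u v) \<star> inv_coeff v
      = \<omega>' ?w' ?w \<star> (?w' \<rhd> f) \<star> ((?w' \<rhd> \<omega> u v) \<star> \<omega> ?w' ?w) \<star> (\<omega>' ?v' v \<star> dom_unit ?v')"
    by (simp add: conj_def inv_coeff_def act_star [OF w'_carrier] unital.assoc)
  also have "\<dots> = \<omega>' ?w' ?w \<star> (?w' \<rhd> f) \<star> \<omega> ?w' u \<star> (\<omega> ?v' v \<star> \<omega>' ?v' v) \<star> dom_unit ?v'"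
    by (simp add: cocycle [OF w'_carrier u_carrier v_carrier] cancel unital.assoc)
  also have "\<dots> = \<omega>' ?w' ?w \<star> (?w' \<rhd> f) \<star> (\<omega> ?w' u \<star> dom_unit (?w' \<otimes> u))"
    by (simp add: cocycle_inverse [OF v'_carrier v_carrier] dom_unit_one
        dom_unit_idem [OF v'_carrier] cancel unital.assoc v_carrier flip: dom_unit_def)
  also have "\<dots> = \<omega>' ?w' ?w \<star> (dom_unit ?w' \<star> (?w' \<rhd> f) \<star> dom_unit ?w')
      \<star> (\<omega> ?w' u \<star> dom_unit (?w' \<otimes> u))"
    by (simp add: act_star_dom_unit [OF w'_carrier] dom_unit_star_act [OF w'_carrier])
  also have "\<dots> = inv_coeff ?w \<star> ((?w' \<rhd> f) \<star> (?w' \<rhd> dom_unit u)) \<star> \<omega> ?w' u"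
    by (simp add: inv_coeff_def act_dom_unit [OF w'_carrier u_carrier]
        dom_unit_central [of "?w' \<otimes> u" "\<omega> ?w' u"] unital.assoc w'_carrier u_carrier)
  finally show ?thesis
    by (simp add: crossed_mult_def act_star [OF w'_carrier] cancel)
qed

lemma crossed_mult_inv_coeff:
  assumes w_carrier: "w \<in> carrier G"
  shows "(w \<rhd> f, w) \<bullet> (inv_coeff w, inv w) = (w \<rhd> f, \<one>)"
proof -
  have "(w \<rhd> f) \<star> (w \<rhd> inv_coeff w) \<star> \<omega> w (inv w)
      = (w \<rhd> f) \<star> ((w \<rhd> \<omega>' (inv w) w) \<star> dom_unit w \<star> \<omega> w (inv w))"
    by (simp add: inv_coeff_def act_star act_dom_unit dom_unit_one unital.assoc w_carrier)
  also have "\<dots> = w \<rhd> f"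
    by (simp add: act_star_dom_unit act_cocycle_inverse_inv w_carrier)
  finally show ?thesis
    by (simp add: crossed_mult_def w_carrier)
qed

end

section \<open>The convolution algebra and the action of points on it\<close>

context kalgebra
begin

definition conv :: "('c::finite \<Rightarrow> 'c \<times> 'c \<Rightarrow> 'k) \<Rightarrow> ('c \<Rightarrow> 'a) \<Rightarrow> ('c \<Rightarrow> 'a) \<Rightarrow> 'c \<Rightarrow> 'a" where
  "conv d f g x = bilin (d x) (\<lambda>a b. f a * g b)"

definition const :: "('c \<Rightarrow> 'k) \<Rightarrow> 'a \<Rightarrow> 'c \<Rightarrow> 'a" where
  "const e a x = \<phi> (e x) * a"

definition pull :: "('c \<Rightarrow> 'i::finite \<Rightarrow> 'k) \<Rightarrow> ('i \<Rightarrow> 'a) \<Rightarrow> 'c \<Rightarrow> 'a" where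
  "pull u f x = lin (u x) f"

lemma conv_assoc:
  assumes "cocomm_coalgebra d e"
  shows "conv d (conv d f g) h = conv d f (conv d g h)"
  using bilin_coassoc [OF assms, where F="\<lambda>a b c. f a * g b * h c"]
  by (simp add: conv_def fun_eq_iff bilin_mult mult_bilin mult.assoc)

lemma conv_const_left:
  assumes "cocomm_coalgebra d e"
  shows "conv d (const e a) f = (\<lambda>x. a * f x)"
  by (rule ext) (simp add: conv_def const_def mult.assoc bilin_counit_left [OF assms])

lemma conv_const_right:
  assumes "cocomm_coalgebra d e"
  shows "conv d f (const e a) = (\<lambda>x. f x * a)"
  by (rule ext) (simp add: conv_def const_def phi_left_commute bilin_counit_right [OF assms])

lemma monoid_conv:
  assumes "cocomm_coalgebra d e"
  shows "Groups.monoid (conv d) (const e 1)"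
  by unfold_locales (simp_all add: conv_assoc [OF assms] conv_const_left [OF assms]
      conv_const_right [OF assms])

lemma pull_conv:
  assumes "coalgebra_map d e d' e' u"
  shows "pull u (conv d' f g) = conv d (pull u f) (pull u g)"
proof
  fix x
  have "pull u (conv d' f g) x = bilin (d x) (\<lambda>a b. lin (u a) (\<lambda>i. lin (u b) (\<lambda>j. f i * g j)))"
    unfolding pull_def conv_def by (rule coalgebra_map_comult [OF assms])
  then show "pull u (conv d' f g) x = conv d (pull u f) (pull u g) x"
    unfolding conv_def pull_def lin_mult by (simp add: mult_lin)
qed

lemma pull_pull: "pull u (pull v f) = pull (v \<circ>\<^sub>k u) f"
  by (rule ext) (simp add: pull_def [abs_def] lin_vec_lin)

lemma pull_bas [simp]: "pull bas f = f"
  by (rule ext) (simp add: pull_def)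

lemma pull_pair_lcomp: "pull (pair d (M \<circ>\<^sub>k u) w) F
    = pull (pair d u w) (\<lambda>(i, k). lin (M i) (\<lambda>l. F (l, k)))"
  by (rule ext) (simp add: pull_def lin_pair lin_vec_lin lin_lin_commute [of "w _"])

lemma pull_pair_lcomp_right:
  "pull (pair d u (M \<circ>\<^sub>k w)) F = pull (pair d u w) (\<lambda>(i, k). lin (M k) (\<lambda>l. F (i, l)))"
  by (rule ext) (simp add: pull_def lin_pair lin_vec_lin)

lemma pull_pair_counit:
  assumes coalg: "cocomm_coalgebra d e" and w_map: "coalgebra_map d e d' e' w"
  shows "pull (pair d u w) (\<lambda>(i, k). \<phi> (e' k) * F i) = pull u F"
proof
  fix x
  have "pull (pair d u w) (\<lambda>(i, k). \<phi> (e' k) * F i) x = bilin (d x) (\<lambda>a b. \<phi> (e b) * lin (u a) F)"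
    by (simp add: pull_def lin_pair coalgebra_map_counit [OF w_map] mult_lin)
  then show "pull (pair d u w) (\<lambda>(i, k). \<phi> (e' k) * F i) x = pull u F x"
    by (simp add: bilin_counit_right [OF coalg] pull_def)
qed

lemma pull_pair_assoc:
  assumes "cocomm_coalgebra d e"
  shows "pull (pair d (pair d u v) w) (\<lambda>((i, j), k). F (i, (j, k)))
      = pull (pair d u (pair d v w)) F"
proof
  fix x
  have "pull (pair d (pair d u v) w) (\<lambda>((i, j), k). F (i, (j, k))) x
      = bilin (d x) (\<lambda>r c. bilin (d r) (\<lambda>a b.
          lin (u a) (\<lambda>i. lin (v b) (\<lambda>j. lin (w c) (\<lambda>k. F (i, (j, k)))))))"
    by (simp add: pull_def lin_pair)
  also have "\<dots> = bilin (d x) (\<lambda>a r. bilin (d r) (\<lambda>b c.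
          lin (u a) (\<lambda>i. lin (v b) (\<lambda>j. lin (w c) (\<lambda>k. F (i, (j, k)))))))"
    by (rule bilin_coassoc [OF assms, symmetric])
  finally show "pull (pair d (pair d u v) w) (\<lambda>((i, j), k). F (i, (j, k))) x
      = pull (pair d u (pair d v w)) F x"
    by (simp add: pull_def lin_pair bilin_lin_commute)
qed

lemma conv_pull_eq_pair: "conv d (pull u f) (pull v g) = pull (pair d u v) (\<lambda>(i, j). f i * g j)"
proof
  fix x
  show "conv d (pull u f) (pull v g) x = pull (pair d u v) (\<lambda>(i, j). f i * g j) x"
    unfolding conv_def pull_def lin_pair lin_mult by (simp add: mult_lin)
qed

lemma pull_pair_comult:
  assumes coalg: "cocomm_coalgebra d e" and w_map: "coalgebra_map d e d' e' w"
  shows "pull (pair d w (pair d w v)) (\<lambda>(i, (j, l)). F i j l)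
    = pull (pair d w v) (\<lambda>(y, l). bilin (d' y) (\<lambda>i j. F i j l))"
proof -
  have "pair d w w = d' \<circ>\<^sub>k w"
    using w_map by (simp add: fun_eq_iff pair_def coalgebra_map_def)
  then show ?thesis
    using pull_pair_assoc [OF coalg, of w w v "\<lambda>(i, (j, l)). F i j l"]
    by (simp add: pull_pair_lcomp bilin_def split_def)
qed

definition coord :: "'i \<Rightarrow> 'i \<Rightarrow> 'a" where
  "coord m i = \<phi> (bas i m)"

lemma lin_coord: "lin v (coord m) = \<phi> (v m)"
proof -
  have "lin v (coord m) = \<phi> (\<Sum>i\<in>UNIV. v i * bas i m)"
    by (simp only: lin_def coord_def phi_sum phi_mult)
  then show ?thesis by simp
qed

lemma pull_coord: "pull u (coord m) x = \<phi> (u x m)"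
  by (simp add: pull_def lin_coord)

lemma sum_conv_pull_coord: "(\<Sum>j\<in>UNIV. conv d f (pull u (coord j)) x * g j) = conv d f (pull u g) x"
  by (simp add: conv_def pull_coord bilin_mult mult.assoc flip: bilin_sum)
     (simp add: pull_def lin_def sum_distrib_left)

lemma hlin_eq_lin:
  assumes "hlin \<phi> f"
  shows "f h = lin h (\<lambda>i. f (bas i))"
proof -
  have f_zero: "f (\<lambda>_. 0) = 0"
    using assms [unfolded hlin_def, rule_format, of "\<lambda>_. 0" "\<lambda>_. 0" 0]
    by (simp add: hsc_def phi_zero)
  have "f (\<lambda>j. if j \<in> S then h j else 0) = (\<Sum>i\<in>S. \<phi> (h i) * f (bas i))" if "finite S" for S
    using that
  proof (induction S rule: finite_induct)
    case empty
    then show ?case using f_zero by simp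
  next
    case (insert s S)
    have "(\<lambda>j. if j \<in> insert s S then h j else 0)
        = hadd (hsc (h s) (bas s)) (\<lambda>j. if j \<in> S then h j else 0)"
      using insert by (auto simp: hadd_def hsc_def bas_def fun_eq_iff)
    then show ?case using insert assms by (simp add: hlin_def)
  qed
  from this [of UNIV] show ?thesis by (simp add: lin_def)
qed

lemma hbilin_eq_lin:
  assumes "hbilin \<phi> f"
  shows "f x y = lin x (\<lambda>i. lin y (\<lambda>j. f (bas i) (bas j)))"
proof -
  have "f x y = lin x (\<lambda>i. f (bas i) y)"
    using assms by (intro hlin_eq_lin [of "\<lambda>x. f x y"]) (simp add: hbilin_def)
  moreover have "f (bas i) y = lin y (\<lambda>j. f (bas i) (bas j))" for i
    using assms by (intro hlin_eq_lin) (simp add: hbilin_def)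
  ultimately show ?thesis by simp
qed

end

locale sym_twisted_partial_action = kalgebra \<phi> + cocomm_hopf H
  for \<phi> :: "'k::field \<Rightarrow> 'a::ring_1" and H :: "('i::finite, 'k) hopf_data" +
  fixes act :: "('i \<Rightarrow> 'k) \<Rightarrow> 'a \<Rightarrow> 'a" and om om' :: "('i \<Rightarrow> 'k) \<Rightarrow> ('i \<Rightarrow> 'k) \<Rightarrow> 'a"
  assumes sym_tpa: "sym_tpa H \<phi> act om om'"
begin

definition act_bas :: "'i \<Rightarrow> 'a \<Rightarrow> 'a" where "act_bas i a = act (bas i) a"

definition om_bas :: "'i \<times> 'i \<Rightarrow> 'a" where "om_bas = (\<lambda>(i, j). om (bas i) (bas j))"

definition om'_bas :: "'i \<times> 'i \<Rightarrow> 'a" where "om'_bas = (\<lambda>(i, j). om' (bas i) (bas j))"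

definition unit_bas :: "'i \<Rightarrow> 'a" where "unit_bas i = act_bas i 1"

abbreviation "\<Delta>\<^sub>2 \<equiv> tensor_comult \<Delta> \<Delta>"

abbreviation "\<epsilon>\<^sub>2 \<equiv> tensor_counit \<epsilon> \<epsilon>"

lemma tpa: "tpa H \<phi> act om"
  using sym_tpa by (simp add: sym_tpa_def)

lemma sw2_bas: "sw2 H \<phi> (bas i) F = bilin (\<Delta> i) (\<lambda>a b. F (bas a) (bas b))"
  by (simp add: sw2_def bilin_def lin_def \<Delta>_def split_def)

lemma act_eq_lin: "act h a = lin h (\<lambda>i. act_bas i a)"
  unfolding act_bas_def using tpa by (intro hlin_eq_lin [of "\<lambda>h. act h a"]) (simp add: tpa_def)

lemma om_eq_lin: "om x y = lin x (\<lambda>i. lin y (\<lambda>j. om_bas (i, j)))"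
  unfolding om_bas_def prod.case using tpa unfolding tpa_def by (intro hbilin_eq_lin) blast

lemma act_bas_add: "act_bas i (a + b) = act_bas i a + act_bas i b"
  and act_bas_phi: "act_bas i (\<phi> x * a) = \<phi> x * act_bas i a"
  using tpa unfolding tpa_def alin_def act_bas_def by blast+

lemma act_bas_sum: "act_bas i (\<Sum>s\<in>S. f s) = (\<Sum>s\<in>S. act_bas i (f s))"
proof -
  have "act_bas i 0 = 0" using act_bas_add [of i 0 0] by simp
  then show ?thesis by (induction S rule: infinite_finite_induct) (simp_all add: act_bas_add)
qed

lemma act_bas_lin: "act_bas i (lin v f) = lin v (\<lambda>p. act_bas i (f p))"
  by (simp add: lin_def act_bas_sum act_bas_phi)

lemma act_bas_bilin: "act_bas i (bilin T F) = bilin T (\<lambda>p q. act_bas i (F p q))"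
  by (simp add: bilin_def act_bas_lin split_def)

lemma act_hone: "lin (hone H) (\<lambda>i. act_bas i a) = a"
  using tpa by (simp add: tpa_def flip: act_eq_lin)

lemma act_bas_mult: "act_bas i (a * b) = bilin (\<Delta> i) (\<lambda>p q. act_bas p a * act_bas q b)"
  using tpa by (simp add: tpa_def sw2_bas act_bas_def)

lemma act_bas_act_bas:
  "bilin (\<Delta> i) (\<lambda>p p'. bilin (\<Delta> j) (\<lambda>q q'. act_bas p (act_bas q a) * om_bas (p', q')))
    = bilin (\<Delta> i) (\<lambda>p p'. bilin (\<Delta> j) (\<lambda>q q'. om_bas (p, q) * lin (\<mu> (p', q')) (\<lambda>k. act_bas k a)))"
proof -
  have "sw2 H \<phi> (bas i) (\<lambda>h1 h2. sw2 H \<phi> (bas j) (\<lambda>l1 l2. act h1 (act l1 a) * om h2 l2))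
      = sw2 H \<phi> (bas i) (\<lambda>h1 h2. sw2 H \<phi> (bas j) (\<lambda>l1 l2. om h1 l1 * act (hmul H h2 l2) a))"
    using tpa unfolding tpa_def by blast
  then show ?thesis
    by (simp add: sw2_bas hmul_bas act_eq_lin om_eq_lin)
qed

lemma unit_bas_central: "unit_bas i * a = a * unit_bas i"
proof -
  have "hlin \<phi> (\<lambda>h. \<phi> (eps H h) * a)"
    by (simp add: hlin_def eps_def hadd_def hsc_def phi_add phi_mult distrib_right sum.distrib
        mult.assoc flip: sum_distrib_left)
  then have "conv1 H \<phi> (\<lambda>h. act h 1) (\<lambda>h. \<phi> (eps H h) * a)
      = conv1 H \<phi> (\<lambda>h. \<phi> (eps H h) * a) (\<lambda>h. act h 1)"
    using sym_tpa by (simp add: sym_tpa_def)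
  then have "conv1 H \<phi> (\<lambda>h. act h 1) (\<lambda>h. \<phi> (eps H h) * a) (bas i)
      = conv1 H \<phi> (\<lambda>h. \<phi> (eps H h) * a) (\<lambda>h. act h 1) (bas i)"
    by simp
  then have "conv \<Delta> unit_bas (const \<epsilon> a) i = conv \<Delta> (const \<epsilon> a) unit_bas i"
    by (simp add: conv1_def sw2_bas conv_def const_def unit_bas_def act_bas_def \<epsilon>_def)
  then show ?thesis
    by (simp add: conv_const_left [OF cocomm_coalgebra] conv_const_right [OF cocomm_coalgebra])
qed

lemma om_bas_hone:
  "lin (hone H) (\<lambda>i. om_bas (i, j)) = unit_bas j"
  "lin (hone H) (\<lambda>i. om_bas (j, i)) = unit_bas j"
proof -
  have "om (hone H) (bas j) = act (bas j) 1" "om (bas j) (hone H) = act (bas j) 1"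
    using sym_tpa unfolding sym_tpa_def by blast+
  then show "lin (hone H) (\<lambda>i. om_bas (i, j)) = unit_bas j"
      "lin (hone H) (\<lambda>i. om_bas (j, i)) = unit_bas j"
    by (simp_all add: om_eq_lin unit_bas_def act_bas_def)
qed

lemma om_bas_cocycle:
  "bilin (\<Delta> i) (\<lambda>p p'. bilin (\<Delta> j) (\<lambda>q q'. bilin (\<Delta> k) (\<lambda>r r'.
      act_bas p (om_bas (q, r)) * lin (\<mu> (q', r')) (\<lambda>l. om_bas (p', l)))))
    = bilin (\<Delta> i) (\<lambda>p p'. bilin (\<Delta> j) (\<lambda>q q'.
        om_bas (p, q) * lin (\<mu> (p', q')) (\<lambda>l. om_bas (l, k))))"
proof -
  have "sw2 H \<phi> (bas i) (\<lambda>h1 h2. sw2 H \<phi> (bas j) (\<lambda>l1 l2. sw2 H \<phi> (bas k) (\<lambda>m1 m2.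
          act h1 (om l1 m1) * om h2 (hmul H l2 m2))))
      = sw2 H \<phi> (bas i) (\<lambda>h1 h2. sw2 H \<phi> (bas j) (\<lambda>l1 l2. om h1 l1 * om (hmul H h2 l2) (bas k)))"
    using sym_tpa unfolding sym_tpa_def by blast
  then show ?thesis
    by (simp add: sw2_bas hmul_bas om_eq_lin act_eq_lin)
qed

lemma act_bas_unit_bas:
  "conv \<Delta>\<^sub>2 (\<lambda>(i, j). \<phi> (\<epsilon> j) * unit_bas i) (pull \<mu> unit_bas) = (\<lambda>(i, k). act_bas i (unit_bas k))"
proof (rule ext, clarify)
  fix i k
  have "act (bas i) (act (bas k) 1)
      = sw2 H \<phi> (bas i) (\<lambda>h1 h2. act h1 1 * act (hmul H h2 (bas k)) 1)"
    using sym_tpa unfolding sym_tpa_def by blast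
  then have "act_bas i (unit_bas k) = bilin (\<Delta> i) (\<lambda>p p'. unit_bas p * pull \<mu> unit_bas (p', k))"
    by (simp add: sw2_bas hmul_bas act_eq_lin pull_def unit_bas_def [abs_def])
  then show "conv \<Delta>\<^sub>2 (\<lambda>(i, j). \<phi> (\<epsilon> j) * unit_bas i) (pull \<mu> unit_bas) (i, k)
      = act_bas i (unit_bas k)"
    by (simp add: conv_def bilin_tensor_comult mult.assoc bilin_counit_left [OF cocomm_coalgebra])
qed

lemma om_bas_inverse:
  "conv \<Delta>\<^sub>2 om_bas om'_bas = (\<lambda>(i, k). act_bas i (unit_bas k))"
  "conv \<Delta>\<^sub>2 om'_bas om_bas = (\<lambda>(i, k). act_bas i (unit_bas k))"
proof -
  have conv2: "conv2 H \<phi> f g (bas i) (bas j)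
      = conv \<Delta>\<^sub>2 (\<lambda>(i, j). f (bas i) (bas j)) (\<lambda>(i, j). g (bas i) (bas j)) (i, j)" for f g i j
    by (simp add: conv_def bilin_tensor_comult conv2_def sw2_bas)
  have units: "act (bas i) 1 * \<phi> (eps H (bas j)) = \<phi> (\<epsilon> j) * unit_bas i"
    "act (hmul H (bas i) (bas j)) 1 = pull \<mu> unit_bas (i, j)" for i j
    by (simp add: unit_bas_def act_bas_def \<epsilon>_def phi_central [of _ "act _ 1"])
       (simp add: hmul_bas act_eq_lin pull_def unit_bas_def [abs_def])
  have "conv2 H \<phi> om om' = conv2 H \<phi> (\<lambda>h l. act h 1 * \<phi> (eps H l)) (\<lambda>h l. act (hmul H h l) 1)"
     "conv2 H \<phi> om' om = conv2 H \<phi> (\<lambda>h l. act h 1 * \<phi> (eps H l)) (\<lambda>h l. act (hmul H h l) 1)"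
    using sym_tpa unfolding sym_tpa_def by blast+
  then have "conv2 H \<phi> om om' (bas i) (bas j) = act_bas i (unit_bas j)"
    "conv2 H \<phi> om' om (bas i) (bas j) = act_bas i (unit_bas j)" for i j
    using fun_cong [OF act_bas_unit_bas, of "(i, j)"] by (simp_all add: conv2 units)
  then show "conv \<Delta>\<^sub>2 om_bas om'_bas = (\<lambda>(i, k). act_bas i (unit_bas k))"
    "conv \<Delta>\<^sub>2 om'_bas om_bas = (\<lambda>(i, k). act_bas i (unit_bas k))"
    by (auto simp: fun_eq_iff conv2 om_bas_def om'_bas_def)
qed

end

locale sym_twisted_partial_action_points = sym_twisted_partial_action \<phi> H act om om'
  for \<phi> :: "'k::field \<Rightarrow> 'a::ring_1" and H :: "('i::finite, 'k) hopf_data" and act om om' +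
  fixes d :: "'c::finite \<Rightarrow> 'c \<times> 'c \<Rightarrow> 'k" and e :: "'c \<Rightarrow> 'k"
  assumes coalgebra: "cocomm_coalgebra d e"
begin

abbreviation star (infixl "\<star>" 70) where "f \<star> g \<equiv> conv d f g"

abbreviation point_mult (infixl "\<odot>" 70) where "u \<odot> v \<equiv> vec_conv d \<mu> u v"

abbreviation "point_one \<equiv> vec_conv_one e (hone H)"

abbreviation "point \<equiv> coalgebra_map d e \<Delta> \<epsilon>"

definition point_act :: "('c \<Rightarrow> 'i \<Rightarrow> 'k) \<Rightarrow> ('c \<Rightarrow> 'a) \<Rightarrow> 'c \<Rightarrow> 'a" (infixr "\<rhd>" 67) where
  "u \<rhd> f = pull (pair d u bas) (\<lambda>(i, c). act_bas i (f c))"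

definition "\<omega> u v = pull (pair d u v) om_bas"

definition "\<omega>' u v = pull (pair d u v) om'_bas"

lemma point_act_apply: "(u \<rhd> f) x = bilin (d x) (\<lambda>a b. lin (u a) (\<lambda>i. act_bas i (f b)))"
  by (simp add: point_act_def pull_def lin_pair)

lemma point_act_pull: "u \<rhd> pull v f = pull (pair d u v) (\<lambda>(i, y). act_bas i (f y))"
  by (rule ext) (simp add: point_act_apply pull_def lin_pair act_bas_lin)

lemma point_act_conv:
  assumes u_point: "point u"
  shows "u \<rhd> (f \<star> g) = (u \<rhd> f) \<star> (u \<rhd> g)"
proof -
  have "(\<lambda>(i, c). act_bas i ((f \<star> g) c))
      = conv (tensor_comult \<Delta> d) (\<lambda>(i, c). act_bas i (f c)) (\<lambda>(i, c). act_bas i (g c))"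
    by (auto simp: fun_eq_iff conv_def bilin_tensor_comult act_bas_bilin act_bas_mult
        intro: bilin_bilin_commute)
  then show ?thesis
    using pull_conv [OF coalgebra_map_pair [OF coalgebra u_point coalgebra_map_bas]]
    by (simp add: point_act_def)
qed

lemma point_act_point_act:
  assumes u_point: "point u" and v_point: "point v"
  shows "(u \<rhd> v \<rhd> f) \<star> \<omega> u v = \<omega> u v \<star> (u \<odot> v \<rhd> f)"
proof -
  let ?D = "tensor_comult \<Delta>\<^sub>2 d" and ?T = "pair d (pair d u v) bas"
  let ?X = "\<lambda>((i, j), c). act_bas i (act_bas j (f c))"
  let ?O = "\<lambda>(z, c). \<phi> (e c) * om_bas z"
  let ?Y = "\<lambda>(z, c). lin (\<mu> z) (\<lambda>l. act_bas l (f c))"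
  have triple: "coalgebra_map d e ?D (tensor_counit \<epsilon>\<^sub>2 e) ?T"
    by (intro coalgebra_map_pair coalgebra u_point v_point coalgebra_map_bas)
  have pull_X: "pull ?T ?X = u \<rhd> v \<rhd> f"
    using pull_pair_assoc [OF coalgebra, of u v bas
        "\<lambda>(i, q). act_bas i (case q of (j, c) \<Rightarrow> act_bas j (f c))"]
    by (simp add: point_act_pull [symmetric] point_act_def [symmetric])
  have pull_O: "pull ?T ?O = \<omega> u v"
    unfolding \<omega>_def by (rule pull_pair_counit [OF coalgebra coalgebra_map_bas])
  have pull_Y: "pull ?T ?Y = u \<odot> v \<rhd> f"
    by (simp add: point_act_def vec_conv_def pull_pair_lcomp)
  have "conv ?D ?X ?O = conv ?D ?O ?Y"
  proof (rule ext, clarify)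
    fix i j c
    have "conv ?D ?X ?O ((i, j), c) = bilin (\<Delta> i) (\<lambda>p p'. bilin (\<Delta> j) (\<lambda>q q'.
        act_bas p (act_bas q (f c)) * om_bas (p', q')))"
      by (simp add: conv_def bilin_tensor_comult phi_left_commute bilin_counit_right [OF coalgebra])
    also have "\<dots> = bilin (\<Delta> i) (\<lambda>p p'. bilin (\<Delta> j) (\<lambda>q q'.
        om_bas (p, q) * lin (\<mu> (p', q')) (\<lambda>l. act_bas l (f c))))"
      by (rule act_bas_act_bas)
    also have "\<dots> = conv ?D ?O ?Y ((i, j), c)"
      by (simp add: conv_def bilin_tensor_comult mult.assoc bilin_counit_left [OF coalgebra])
    finally show "conv ?D ?X ?O ((i, j), c) = conv ?D ?O ?Y ((i, j), c)" .
  qed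
  then have "pull ?T (conv ?D ?X ?O) = pull ?T (conv ?D ?O ?Y)" by simp
  then show ?thesis
    by (simp only: pull_conv [OF triple] pull_X pull_Y pull_O)
qed

lemma point_cocycle:
  assumes u_point: "point u" and v_point: "point v" and w_point: "point w"
  shows "(u \<rhd> \<omega> v w) \<star> \<omega> u (v \<odot> w) = \<omega> u v \<star> \<omega> (u \<odot> v) w"
proof -
  let ?D = "tensor_comult \<Delta>\<^sub>2 \<Delta>" and ?T = "pair d (pair d u v) w"
  let ?X = "\<lambda>((i, j), k). act_bas i (om_bas (j, k))"
  let ?Y = "\<lambda>((i, j), k). lin (\<mu> (j, k)) (\<lambda>l. om_bas (i, l))"
  let ?O = "\<lambda>(z, k). \<phi> (\<epsilon> k) * om_bas z"
  let ?Z = "\<lambda>(z, k). lin (\<mu> z) (\<lambda>l. om_bas (l, k))"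
  have triple: "coalgebra_map d e ?D (tensor_counit \<epsilon>\<^sub>2 \<epsilon>) ?T"
    by (intro coalgebra_map_pair coalgebra u_point v_point w_point)
  have pull_X: "pull ?T ?X = u \<rhd> \<omega> v w"
    using pull_pair_assoc [OF coalgebra, of u v w "\<lambda>(i, q). act_bas i (om_bas q)"]
    by (simp add: \<omega>_def point_act_pull)
  have pull_Y: "pull ?T ?Y = \<omega> u (v \<odot> w)"
    using pull_pair_assoc [OF coalgebra, of u v w "\<lambda>(i, q). lin (\<mu> q) (\<lambda>l. om_bas (i, l))"]
    by (simp add: \<omega>_def vec_conv_def pull_pair_lcomp_right)
  have pull_O: "pull ?T ?O = \<omega> u v"
    unfolding \<omega>_def by (rule pull_pair_counit [OF coalgebra w_point])
  have pull_Z: "pull ?T ?Z = \<omega> (u \<odot> v) w"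
    by (simp add: \<omega>_def vec_conv_def pull_pair_lcomp)
  have "conv ?D ?X ?Y = conv ?D ?O ?Z"
  proof (rule ext, clarify)
    fix i j k
    have "conv ?D ?X ?Y ((i, j), k) = bilin (\<Delta> i) (\<lambda>p p'. bilin (\<Delta> j) (\<lambda>q q'.
        om_bas (p, q) * lin (\<mu> (p', q')) (\<lambda>l. om_bas (l, k))))"
      by (simp add: conv_def bilin_tensor_comult om_bas_cocycle)
    also have "\<dots> = conv ?D ?O ?Z ((i, j), k)"
      by (simp add: conv_def bilin_tensor_comult mult.assoc bilin_counit_left [OF cocomm_coalgebra])
    finally show "conv ?D ?X ?Y ((i, j), k) = conv ?D ?O ?Z ((i, j), k)" .
  qed
  then have "pull ?T (conv ?D ?X ?Y) = pull ?T (conv ?D ?O ?Z)" by simp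
  then show ?thesis
    by (simp only: pull_conv [OF triple] pull_X pull_Y pull_O pull_Z)
qed

lemma point_act_const: "u \<rhd> const e a = pull u (\<lambda>i. act_bas i a)"
proof -
  have "(\<lambda>(i, c). act_bas i (const e a c)) = (\<lambda>(i, c). \<phi> (e c) * act_bas i a)"
    by (simp add: const_def act_bas_phi)
  then show ?thesis
    unfolding point_act_def by (simp only: pull_pair_counit [OF coalgebra coalgebra_map_bas])
qed

lemma point_act_unit: "u \<rhd> const e 1 = pull u unit_bas"
  by (simp add: point_act_const unit_bas_def [abs_def])

lemma point_act_one: "point_one \<rhd> f = f"
  by (rule ext) (simp add: point_act_apply vec_conv_one_def lin_scale act_hone
      bilin_counit_left [OF coalgebra])

lemma point_cocycle_one: "\<omega> point_one u = pull u unit_bas" "\<omega> u point_one = pull u unit_bas"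
proof -
  have "\<omega> point_one u x
      = bilin (d x) (\<lambda>a b. \<phi> (e a) * lin (u b) (\<lambda>j. lin (hone H) (\<lambda>i. om_bas (i, j))))" for x
    by (simp add: \<omega>_def pull_def lin_pair vec_conv_one_def lin_scale lin_lin_commute [of "hone H"])
  then show "\<omega> point_one u = pull u unit_bas"
    by (simp add: fun_eq_iff om_bas_hone bilin_counit_left [OF coalgebra] pull_def)
  have "\<omega> u point_one x
      = bilin (d x) (\<lambda>a b. \<phi> (e b) * lin (u a) (\<lambda>j. lin (hone H) (\<lambda>i. om_bas (j, i))))" for x
    by (simp add: \<omega>_def pull_def lin_pair vec_conv_one_def lin_scale flip: mult_lin)
  then show "\<omega> u point_one = pull u unit_bas"
    by (simp add: fun_eq_iff om_bas_hone bilin_counit_right [OF coalgebra] pull_def)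
qed

lemma pull_unit_bas_central: "pull u unit_bas \<star> f = f \<star> pull u unit_bas"
proof
  fix x
  have "pull u unit_bas a * f b = f b * pull u unit_bas a" for a b
    by (simp add: pull_def lin_mult mult_lin unit_bas_central)
  then show "(pull u unit_bas \<star> f) x = (f \<star> pull u unit_bas) x"
    unfolding conv_def by (subst bilin_cocomm [OF coalgebra]) simp
qed

lemma point_act_pull_unit_bas:
  assumes u_point: "point u" and v_point: "point v"
  shows "u \<rhd> pull v unit_bas = pull u unit_bas \<star> pull (u \<odot> v) unit_bas"
proof -
  have "u \<rhd> pull v unit_bas
      = pull (pair d u v) (conv \<Delta>\<^sub>2 (\<lambda>(i, j). \<phi> (\<epsilon> j) * unit_bas i) (pull \<mu> unit_bas))"
    by (simp add: point_act_pull act_bas_unit_bas)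
  then show ?thesis
    by (simp add: pull_conv [OF coalgebra_map_pair [OF coalgebra u_point v_point]]
        pull_pair_counit [OF coalgebra v_point] pull_pull vec_conv_def)
qed

lemma point_cocycle_inverse:
  assumes u_point: "point u" and v_point: "point v"
  shows "\<omega> u v \<star> \<omega>' u v = pull u unit_bas \<star> pull (u \<odot> v) unit_bas"
    "\<omega>' u v \<star> \<omega> u v = pull u unit_bas \<star> pull (u \<odot> v) unit_bas"
  using point_act_pull_unit_bas [OF u_point v_point]
      pull_conv [OF coalgebra_map_pair [OF coalgebra u_point v_point], symmetric]
  by (simp_all add: \<omega>_def \<omega>'_def om_bas_inverse point_act_pull)

sublocale twisted_partial_group_action "point_group d e" "conv d" "const e 1" point_act \<omega> \<omega>'
proof -
  interpret group "point_group d e" by (rule group_point_group [OF coalgebra])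
  interpret unital: Groups.monoid "conv d" "const e 1" by (rule monoid_conv [OF coalgebra])
  show "twisted_partial_group_action (point_group d e) (conv d) (const e 1) point_act \<omega> \<omega>'"
    by unfold_locales
      (simp_all add: point_act_one point_act_conv point_act_unit point_act_pull_unit_bas
          point_act_point_act point_cocycle point_cocycle_one point_cocycle_inverse,
        rule pull_unit_bas_central)
qed

lemma dom_unit_eq: "dom_unit u = pull u unit_bas"
  by (simp add: dom_unit_def point_act_unit)

end

section \<open>The partial crossed product\<close>

context sym_twisted_partial_action
begin

abbreviation smash_mult (infixl "\<diamondop>" 70) where
  "x \<diamondop> y \<equiv> smul H \<phi> act om x y"

abbreviation "B \<equiv> smash_set H \<phi> act"

abbreviation "incl a \<equiv> sharp H \<phi> act a (hone H)"

definition mult_coeff :: "'i \<Rightarrow> 'i \<times> 'i \<Rightarrow> 'a" where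
  "mult_coeff m = conv \<Delta>\<^sub>2 om_bas (pull \<mu> (coord m))"

lemma sw3_bas:
  "sw3 H \<phi> (bas i) F = bilin (\<Delta> i) (\<lambda>a r. bilin (\<Delta> r) (\<lambda>b c. F (bas a) (bas b) (bas c)))"
proof -
  have "hcom H l i j = \<Delta> l (i, j)" for l i j
    by (simp add: \<Delta>_def cop_def)
  then have "cop3 H (bas i) (p, q, r) = (\<Sum>u\<in>UNIV. \<Delta> i (u, r) * \<Delta> u (p, q))" for p q r
    by (simp add: cop3_def mult.assoc flip: sum_distrib_left)
  then have "sw3 H \<phi> (bas i) F = bilin (\<Delta> i) (\<lambda>r c. bilin (\<Delta> r) (\<lambda>a b. F (bas a) (bas b) (bas c)))"
    by (simp add: sw3_def sum_UNIV_prod bilin_bilin_left)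
  then show ?thesis
    by (simp only: bilin_coassoc [OF cocomm_coalgebra])
qed

lemma smul_eq_bilin:
  "(x \<diamondop> y) m
    = (\<Sum>i\<in>UNIV. x i * (\<Sum>j\<in>UNIV. bilin (\<Delta> i) (\<lambda>a b. act_bas a (y j) * mult_coeff m (b, j))))"
proof -
  have "sw3 H \<phi> (bas i) (\<lambda>h1 h2 h3. sw2 H \<phi> (bas j) (\<lambda>l1 l2.
        x i * act h1 (y j) * om h2 l1 * \<phi> (hmul H h3 l2 m)))
      = x i * bilin (\<Delta> i) (\<lambda>a b. act_bas a (y j) * mult_coeff m (b, j))" for i j
    by (simp add: sw3_bas sw2_bas mult_coeff_def conv_def bilin_tensor_comult pull_coord hmul_bas
        act_eq_lin om_eq_lin mult_bilin mult.assoc)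
  then show ?thesis by (simp add: smul_def sum_distrib_left)
qed

lemma smul_sum_left: "(\<Sum>s\<in>S. x s) \<diamondop> y = (\<Sum>s\<in>S. x s \<diamondop> y)"
proof
  fix m
  show "((\<Sum>s\<in>S. x s) \<diamondop> y) m = (\<Sum>s\<in>S. x s \<diamondop> y) m"
    unfolding sum_fun_apply smul_eq_bilin sum_distrib_right by (rule sum.swap)
qed

lemma smul_sum_right: "y \<diamondop> (\<Sum>s\<in>S. x s) = (\<Sum>s\<in>S. y \<diamondop> x s)"
proof
  fix m
  let ?F = "\<lambda>i j s. bilin (\<Delta> i) (\<lambda>a b. act_bas a (x s j) * mult_coeff m (b, j))"
  have "(y \<diamondop> (\<Sum>s\<in>S. x s)) m = (\<Sum>i\<in>UNIV. y i * (\<Sum>j\<in>UNIV. \<Sum>s\<in>S. ?F i j s))"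
    by (simp add: smul_eq_bilin act_bas_sum sum_distrib_right bilin_sum)
  also have "\<dots> = (\<Sum>i\<in>UNIV. \<Sum>s\<in>S. y i * (\<Sum>j\<in>UNIV. ?F i j s))"
    by (subst sum.swap) (simp only: sum_distrib_left)
  also have "\<dots> = (\<Sum>s\<in>S. y \<diamondop> x s) m"
    unfolding sum_fun_apply smul_eq_bilin by (rule sum.swap)
  finally show "(y \<diamondop> (\<Sum>s\<in>S. x s)) m = (\<Sum>s\<in>S. y \<diamondop> x s) m" .
qed

lemma smul_mult_left: "(\<lambda>m. a * x m) \<diamondop> y = (\<lambda>m. a * (x \<diamondop> y) m)"
  by (rule ext) (simp add: smul_eq_bilin sum_distrib_left mult.assoc)

lemma smul_phi_right: "y \<diamondop> (\<lambda>m. \<phi> a * x m) = (\<lambda>m. \<phi> a * (y \<diamondop> x) m)"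
  by (rule ext) (simp add: smul_eq_bilin act_bas_phi mult.assoc sum_distrib_left
      phi_left_commute [of "y _"] flip: mult_bilin)

lemma lin_fun_eq_sum: "(\<lambda>m. lin v (\<lambda>q. x q m)) = (\<Sum>q\<in>UNIV. (\<lambda>m. \<phi> (v q) * x q m))"
  by (simp add: fun_eq_iff lin_def)

lemma smul_lin_left: "((\<lambda>m. lin v (\<lambda>q. x q m)) \<diamondop> y) m = lin v (\<lambda>q. (x q \<diamondop> y) m)"
  unfolding lin_fun_eq_sum [of v x] by (simp add: smul_sum_left smul_mult_left lin_def)

lemma smul_lin_right: "(y \<diamondop> (\<lambda>m. lin v (\<lambda>q. x q m))) m = lin v (\<lambda>q. (y \<diamondop> x q) m)"
  unfolding lin_fun_eq_sum [of v x] by (simp add: smul_sum_right smul_phi_right lin_def)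

text \<open>With \<open>\<gamma>(h) = 1 # h\<close>, this is \<open>\<gamma>(h) c = (h\<^sub>1 \<cdot> c) # h\<^sub>2\<close>.\<close>

definition gamma :: "'a \<Rightarrow> 'i \<Rightarrow> 'i \<Rightarrow> 'a" where
  "gamma c k m = conv \<Delta> (\<lambda>i. act_bas i c) (coord m) k"

lemma gamma_phi: "gamma (\<phi> x * a) k m = \<phi> x * gamma a k m"
  by (simp add: gamma_def conv_def act_bas_phi mult.assoc mult_bilin)

lemma gamma_bilin: "gamma (bilin T F) k m = bilin T (\<lambda>p q. gamma (F p q) k m)"
  by (simp add: gamma_def conv_def act_bas_bilin bilin_mult bilin_bilin_commute [of "\<Delta> k"])

lemma sharp_eq_mult_gamma: "sharp H \<phi> act a h m = lin h (\<lambda>i. a * gamma 1 i m)"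
proof -
  have "sharp H \<phi> act a h m = lin h (\<lambda>i. sharp H \<phi> act a (bas i) m)"
    by (simp add: sharp_def sw2_def cop_eq_lin flip: lin_def lin_vec_lin)
  also have "\<dots> = lin h (\<lambda>i. a * gamma 1 i m)"
    by (simp add: sharp_def sw2_bas gamma_def conv_def coord_def act_bas_def mult_bilin mult.assoc)
  finally show ?thesis .
qed

lemma sharp_bas: "sharp H \<phi> act a (bas i) = (\<lambda>m. a * gamma 1 i m)"
  by (simp add: fun_eq_iff sharp_eq_mult_gamma)

lemma incl_apply: "incl a m = a * \<phi> (hone H m)"
proof -
  have "incl a m = a * bilin (vec.lin (hone H) \<Delta>) (\<lambda>p q. act_bas p 1 * coord m q)"
    by (simp add: sharp_eq_mult_gamma gamma_def conv_def bilin_vec_lin mult_lin)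
  also have "\<dots> = a * (lin (hone H) (\<lambda>i. act_bas i 1) * lin (hone H) (coord m))"
    by (simp add: comult_one bilin_tensor flip: mult_lin lin_mult)
  finally show ?thesis
    by (simp add: act_hone lin_coord)
qed

text \<open>The projection \<open>x \<mapsto> x (1 # 1)\<close> of \<open>A \<otimes> H\<close> onto the crossed product, in coordinates.\<close>

definition smash_proj :: "('i \<Rightarrow> 'a) \<Rightarrow> 'i \<Rightarrow> 'a" where
  "smash_proj x m = (\<Sum>j\<in>UNIV. x j * gamma 1 j m)"

lemma smash_proj_sum: "smash_proj (\<Sum>s\<in>S. x s) = (\<Sum>s\<in>S. smash_proj (x s))"
proof
  fix m
  show "smash_proj (\<Sum>s\<in>S. x s) m = (\<Sum>s\<in>S. smash_proj (x s)) m"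
    unfolding smash_proj_def sum_fun_apply sum_distrib_right by (rule sum.swap)
qed

lemma smash_proj_mult: "smash_proj (\<lambda>m. q * x m) = (\<lambda>m. q * smash_proj x m)"
  by (rule ext) (simp add: smash_proj_def sum_distrib_left mult.assoc)

lemma smash_proj_gamma: "smash_proj (gamma a k) = gamma a k"
proof
  fix m
  have "conv \<Delta> (\<lambda>i. act_bas i a) (\<lambda>i. act_bas i 1) = (\<lambda>i. act_bas i a)"
    by (simp add: fun_eq_iff conv_def flip: act_bas_mult)
  then have "conv \<Delta> (\<lambda>i. act_bas i a) (conv \<Delta> (\<lambda>i. act_bas i 1) (coord m)) k = gamma a k m"
    by (simp add: gamma_def flip: conv_assoc [OF cocomm_coalgebra])
  then show "smash_proj (gamma a k) m = gamma a k m"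
    using sum_conv_pull_coord [of \<Delta> "\<lambda>i. act_bas i a" bas k]
    by (simp add: smash_proj_def gamma_def [abs_def])
qed

lemma smash_proj_sharp: "smash_proj (sharp H \<phi> act a h) = sharp H \<phi> act a h"
proof -
  have "sharp H \<phi> act a h = (\<Sum>i\<in>UNIV. (\<lambda>m. \<phi> (h i) * (a * gamma 1 i m)))"
    by (simp add: fun_eq_iff sharp_eq_mult_gamma lin_def)
  then show ?thesis
    by (simp add: smash_proj_sum smash_proj_mult smash_proj_gamma)
qed

lemma smash_proj_eq_sum_sharp: "smash_proj x = (\<Sum>i\<in>UNIV. sharp H \<phi> act (x i) (bas i))"
  by (simp add: fun_eq_iff smash_proj_def sharp_bas)

lemma smash_set_iff: "x \<in> B \<longleftrightarrow> smash_proj x = x"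
proof
  assume "x \<in> B"
  then obtain n :: nat and a h where "x = (\<lambda>m. \<Sum>j<n. sharp H \<phi> act (a j) (h j) m)"
    unfolding smash_set_def by blast
  then have "x = (\<Sum>j<n. sharp H \<phi> act (a j) (h j))"
    by (simp add: fun_eq_iff)
  then show "smash_proj x = x"
    by (simp add: smash_proj_sum smash_proj_sharp)
next
  assume fixed: "smash_proj x = x"
  obtain b :: "nat \<Rightarrow> 'i" where bij_b: "bij_betw b {0..<card (UNIV :: 'i set)} UNIV"
    using ex_bij_betw_nat_finite [of "UNIV :: 'i set"] by auto
  have "x = (\<Sum>i\<in>UNIV. sharp H \<phi> act (x i) (bas i))"
    by (simp add: fixed flip: smash_proj_eq_sum_sharp)
  also have "\<dots> = (\<lambda>m. \<Sum>j<card (UNIV :: 'i set). sharp H \<phi> act (x (b j)) (bas (b j)) m)"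
    by (simp add: fun_eq_iff sum.reindex_bij_betw [OF bij_b, symmetric] lessThan_atLeast0)
  finally show "x \<in> B"
    unfolding smash_set_def by (intro CollectI exI)
qed

lemma smash_set_eq_sum_sharp: "x \<in> B \<Longrightarrow> x = (\<Sum>i\<in>UNIV. sharp H \<phi> act (x i) (bas i))"
  by (simp add: smash_set_iff smash_proj_eq_sum_sharp)

lemma smash_set_zero: "0 \<in> B"
  by (simp add: smash_set_iff smash_proj_def fun_eq_iff)

lemma smash_set_add: "x \<in> B \<Longrightarrow> y \<in> B \<Longrightarrow> x + y \<in> B"
  by (simp add: smash_set_iff smash_proj_def fun_eq_iff distrib_right sum.distrib)

lemma smash_set_sum: "(\<And>s. s \<in> S \<Longrightarrow> x s \<in> B) \<Longrightarrow> (\<Sum>s\<in>S. x s) \<in> B"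
  by (simp add: smash_set_iff smash_proj_sum)

lemma smash_set_mult: "x \<in> B \<Longrightarrow> (\<lambda>m. q * x m) \<in> B"
  by (simp add: smash_set_iff smash_proj_mult)

lemma smash_set_lin: "(\<And>p. x p \<in> B) \<Longrightarrow> (\<lambda>m. lin v (\<lambda>p. x p m)) \<in> B"
  unfolding lin_fun_eq_sum [of v x] by (simp add: smash_set_sum smash_set_mult)

lemma gamma_in_smash_set: "gamma c k \<in> B"
  by (simp add: smash_set_iff smash_proj_gamma)

text \<open>The partial convolution inverse \<open>\<gamma>'(h) = \<omega>'(S(h\<^sub>1), h\<^sub>2) # S(h\<^sub>3)\<close> of \<open>\<gamma>\<close>.\<close>

definition gamma_inv :: "'i \<Rightarrow> 'i \<Rightarrow> 'a" where
  "gamma_inv k m = conv \<Delta> (conv \<Delta> (pull (pair \<Delta> antipode bas) om'_bas) (pull antipode unit_bas))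
     (pull antipode (coord m)) k"

end

context sym_twisted_partial_action_points
begin

notation crossed_mult (infixl "\<bullet>" 70)

abbreviation "point_inv u \<equiv> inv\<^bsub>point_group d e\<^esub> u"

text \<open>\<open>hash (f, u)\<close> is the function \<open>x \<mapsto> f(x\<^sub>1) # u(x\<^sub>2)\<close> from the coalgebra to the crossed product.\<close>

definition hash :: "('c \<Rightarrow> 'a) \<times> ('c \<Rightarrow> 'i \<Rightarrow> 'k) \<Rightarrow> 'c \<Rightarrow> 'i \<Rightarrow> 'a" where
  "hash p x m = (fst p \<star> pull (snd p) (coord m)) x"

definition smash_conv :: "('c \<Rightarrow> 'i \<Rightarrow> 'a) \<Rightarrow> ('c \<Rightarrow> 'i \<Rightarrow> 'a) \<Rightarrow> 'c \<Rightarrow> 'i \<Rightarrow> 'a" where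
  "smash_conv f g x m = bilin (d x) (\<lambda>a b. (f a \<diamondop> g b) m)"

lemma sum_hash_mult: "(\<Sum>i\<in>UNIV. hash (f, u) x i * G i) = (f \<star> pull u G) x"
  by (simp add: hash_def sum_conv_pull_coord)

lemma act_bas_hash: "act_bas h (hash (f, u) x i) = hash (\<lambda>c. act_bas h (f c), u) x i"
proof -
  have "act_bas h (a * \<phi> s) = act_bas h a * \<phi> s" for a s
    by (metis act_bas_phi phi_central)
  then show ?thesis by (simp add: hash_def conv_def pull_coord act_bas_bilin)
qed

lemma star_hash: "(f \<star> (\<lambda>x. hash (g, u) x m)) x = hash (f \<star> g, u) x m"
  by (simp add: hash_def [abs_def] unital.assoc)

lemma hash_one: "hash (f, point_one) x = incl (f x)"
proof
  fix m
  have "pull point_one (coord m) = const e (\<phi> (hone H m))"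
    by (simp add: fun_eq_iff pull_coord vec_conv_one_def const_def phi_mult)
  then show "hash (f, point_one) x m = incl (f x) m"
    by (simp add: hash_def conv_const_right [OF coalgebra] incl_apply)
qed

lemma hash_in_smash_set:
  assumes u_point: "point u" and f_absorb: "f \<star> dom_unit u = f"
  shows "hash (f, u) x \<in> B"
proof -
  have "smash_proj (hash (f, u) x) m = hash (f, u) x m" for m
  proof -
    have "smash_proj (hash (f, u) x) m = (f \<star> pull u (conv \<Delta> unit_bas (coord m))) x"
      by (simp add: smash_proj_def sum_hash_mult gamma_def [abs_def] unit_bas_def [abs_def])
    also have "\<dots> = (f \<star> dom_unit u \<star> pull u (coord m)) x"
      by (simp add: pull_conv [OF u_point] dom_unit_eq unital.assoc)
    finally show ?thesis by (simp add: f_absorb hash_def)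
  qed
  then show ?thesis by (simp add: smash_set_iff fun_eq_iff)
qed

lemma act_star_pull_pair:
  assumes u_point: "point u"
  shows "((u \<rhd> g) \<star> pull (pair d u v) F) x
    = bilin (d x) (\<lambda>b z. lin (u b) (\<lambda>i. bilin (\<Delta> i) (\<lambda>h h'.
        bilin (d z) (\<lambda>a' b'. act_bas h (g a') * lin (v b') (\<lambda>j. F (h', j))))))"
proof -
  let ?K = "\<lambda>s a' s' b'. lin (u s) (\<lambda>h. lin (u s')
      (\<lambda>h'. act_bas h (g a') * lin (v b') (\<lambda>j. F (h', j))))"
  have "bilin (d x) (\<lambda>b z. lin (u b) (\<lambda>i. bilin (\<Delta> i) (\<lambda>h h'.
        bilin (d z) (\<lambda>a' b'. act_bas h (g a') * lin (v b') (\<lambda>j. F (h', j))))))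
      = bilin (d x) (\<lambda>b z. bilin (d b) (\<lambda>s s'. bilin (d z) (\<lambda>a' b'. ?K s a' s' b')))"
    by (simp add: coalgebra_map_comult [OF u_point] bilin_lin_commute)
  also have "\<dots> = bilin (d x) (\<lambda>y z. bilin (d y) (\<lambda>s a'. bilin (d z) (\<lambda>s' b'. ?K s a' s' b')))"
    by (rule bilin_interchange [OF coalgebra])
  finally show ?thesis
    by (simp add: conv_def point_act_apply pull_def lin_pair bilin_mult lin_mult)
       (simp add: mult_bilin mult_lin bilin_lin_commute)
qed

lemma smash_conv_hash:
  assumes u_point: "point u" and v_point: "point v"
  shows "smash_conv (hash (f, u)) (hash (g, v)) = hash ((f, u) \<bullet> (g, v))"
proof (intro ext)
  fix x m
  let ?L = "\<lambda>b z. lin (u b) (\<lambda>i. bilin (\<Delta> i) (\<lambda>h h'.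
      bilin (d z) (\<lambda>a' b'. act_bas h (g a') * lin (v b') (\<lambda>j. mult_coeff m (h', j)))))"
  have "smash_conv (hash (f, u)) (hash (g, v)) x m
      = bilin (d x) (\<lambda>y z. bilin (d y) (\<lambda>a b. f a * ?L b z))"
    by (simp add: smash_conv_def smul_eq_bilin act_bas_hash sum_hash_mult conv_def pull_def
        flip: bilin_sum)
  also have "\<dots> = bilin (d x) (\<lambda>a r. bilin (d r) (\<lambda>b z. f a * ?L b z))"
    by (rule bilin_coassoc [OF coalgebra, symmetric])
  also have "\<dots> = (f \<star> ((u \<rhd> g) \<star> pull (pair d u v) (mult_coeff m))) x"
    by (simp add: conv_def [of d f] act_star_pull_pair [OF u_point] flip: mult_bilin)
  also have "pull (pair d u v) (mult_coeff m) = \<omega> u v \<star> pull (u \<odot> v) (coord m)"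
    by (simp add: mult_coeff_def pull_conv [OF coalgebra_map_pair [OF coalgebra u_point v_point]]
        pull_pull \<omega>_def vec_conv_def)
  finally show "smash_conv (hash (f, u)) (hash (g, v)) x m = hash ((f, u) \<bullet> (g, v)) x m"
    unfolding hash_def [of "_ \<bullet> _"] by (simp add: crossed_mult_def unital.assoc)
qed

lemma smash_conv_pull:
  "smash_conv (\<lambda>x m. pull u (\<lambda>i. f i m) x) (\<lambda>x m. pull v (\<lambda>j. g j m) x) x m
    = pull (pair d u v) (\<lambda>(i, j). (f i \<diamondop> g j) m) x"
  by (simp add: smash_conv_def pull_def lin_pair smul_lin_left smul_lin_right)

lemma incl_const: "incl (const e q b) = (\<lambda>m. \<phi> (e b) * incl q m)"
  by (simp add: fun_eq_iff incl_apply const_def mult.assoc)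

lemma smash_conv_incl_right: "smash_conv f (hash (const e q, point_one)) x = f x \<diamondop> incl q"
  by (rule ext) (simp add: smash_conv_def hash_one incl_const smul_phi_right
      bilin_counit_right [OF coalgebra])

lemma smash_conv_incl_left: "smash_conv (hash (const e q, point_one)) f x = incl q \<diamondop> f x"
  by (rule ext) (simp add: smash_conv_def hash_one incl_const smul_mult_left
      bilin_counit_left [OF coalgebra])

lemma pull_gamma:
  assumes w_point: "point w"
  shows "pull w (\<lambda>i. gamma c i m) x = hash (w \<rhd> const e c, w) x m"
  by (simp add: gamma_def [abs_def] pull_conv [OF w_point] hash_def point_act_const)

lemma pull_sharp_bas:
  assumes w_point: "point w"
  shows "pull w (\<lambda>i. sharp H \<phi> act a (bas i) m) x = hash (const e a \<star> dom_unit w, w) x m"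
proof -
  have "pull w (\<lambda>i. sharp H \<phi> act a (bas i) m) x = a * pull w (\<lambda>i. gamma 1 i m) x"
    by (simp add: sharp_bas pull_def mult_lin)
  then show ?thesis
    by (simp add: pull_gamma [OF w_point] hash_def dom_unit_def unital.assoc
        conv_const_left [OF coalgebra, of a "_ \<star> _"])
qed

lemma pull_gamma_inv:
  assumes w_point: "point w"
  shows "pull w (\<lambda>i. gamma_inv i m) x = hash (inv_coeff w, point_inv w) x m"
  by (simp add: gamma_inv_def [abs_def] pull_conv [OF w_point] pull_pull pair_comp [OF w_point]
      hash_def inv_coeff_def dom_unit_eq \<omega>'_def inv_point [OF coalgebra w_point])

lemma hash_act_eq_gamma:
  assumes w_point: "point w"
  shows "hash (w \<rhd> f, w) x m = bilin (d x) (\<lambda>a b. lin (w a) (\<lambda>k. gamma (f b) k m))"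
proof -
  let ?F = "\<lambda>a b c. lin (w a) (\<lambda>h. lin (w b) (\<lambda>h'. act_bas h (f c) * coord m h'))"
  have "hash (w \<rhd> f, w) x m = bilin (d x) (\<lambda>r b. bilin (d r) (\<lambda>a c. ?F a b c))"
    by (simp add: hash_def conv_def point_act_apply pull_def bilin_mult lin_mult)
       (simp add: mult_lin)
  also have "\<dots> = bilin (d x) (\<lambda>a r. bilin (d r) (\<lambda>c b. ?F a b c))"
    by (rule bilin_coassoc [OF coalgebra, symmetric])
  also have "\<dots> = bilin (d x) (\<lambda>a r. bilin (d r) (\<lambda>b c. ?F a b c))"
    by (subst bilin_cocomm [OF coalgebra]) (rule refl)
  also have "\<dots> = bilin (d x) (\<lambda>r c. bilin (d r) (\<lambda>a b. ?F a b c))"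
    by (rule bilin_coassoc [OF coalgebra])
  finally show ?thesis
    by (simp add: gamma_def conv_def coalgebra_map_comult [OF w_point])
qed

end

section \<open>The separability element\<close>

context sym_twisted_partial_action
begin

lemma sym_twisted_partial_action_pointsI:
  "cocomm_coalgebra d e \<Longrightarrow> sym_twisted_partial_action_points \<phi> H act om om' d e"
  by (simp add: sym_twisted_partial_action_points_def sym_twisted_partial_action_points_axioms_def
      sym_twisted_partial_action_axioms)

lemma cocomm_coalgebra_square: "cocomm_coalgebra \<Delta>\<^sub>2 \<epsilon>\<^sub>2"
  by (rule cocomm_coalgebra_tensor [OF cocomm_coalgebra cocomm_coalgebra])

sublocale self: sym_twisted_partial_action_points \<phi> H act om om' \<Delta> \<epsilon>
  by (rule sym_twisted_partial_action_pointsI [OF cocomm_coalgebra])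

sublocale square: sym_twisted_partial_action_points \<phi> H act om om' \<Delta>\<^sub>2 \<epsilon>\<^sub>2
  by (rule sym_twisted_partial_action_pointsI [OF cocomm_coalgebra_square])

lemma inv_bas: "self.point_inv bas = antipode"
  by (simp add: inv_point [OF cocomm_coalgebra coalgebra_map_bas])

lemma gamma_eq_hash: "gamma c = self.hash (self.point_act bas (const \<epsilon> c), bas)"
  by (intro ext) (simp flip: self.pull_gamma [OF coalgebra_map_bas])

lemma sharp_bas_eq_hash:
  "sharp H \<phi> act a (bas i) = self.hash (conv \<Delta> (const \<epsilon> a) (self.dom_unit bas), bas) i"
  by (rule ext) (simp flip: self.pull_sharp_bas [OF coalgebra_map_bas])

lemma gamma_inv_eq_hash: "gamma_inv = self.hash (self.inv_coeff bas, self.point_inv bas)"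
  by (intro ext) (simp flip: self.pull_gamma_inv [OF coalgebra_map_bas])

lemma gamma_inv_in_smash_set: "gamma_inv k \<in> B"
  unfolding gamma_inv_eq_hash
  by (rule self.hash_in_smash_set)
     (simp_all add: self.inv_coeff_star_dom_unit coalgebra_map_bas,
      simp add: inv_bas coalgebra_map_antipode)

lemma incl_smul_sharp_bas: "incl q \<diamondop> sharp H \<phi> act a (bas i) = sharp H \<phi> act (q * a) (bas i)"
proof -
  let ?f = "conv \<Delta> (const \<epsilon> a) (self.dom_unit bas)"
  have "conv \<Delta> (const \<epsilon> q) (const \<epsilon> a) = const \<epsilon> (q * a)"
    by (simp add: conv_const_left [OF cocomm_coalgebra] const_def fun_eq_iff phi_left_commute)
  then have "self.crossed_mult (const \<epsilon> q, vec_conv_one \<epsilon> (hone H)) (?f, bas)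
      = (conv \<Delta> (const \<epsilon> (q * a)) (self.dom_unit bas), bas)"
    by (simp add: self.crossed_mult_def self.point_act_one self.point_cocycle_one self.unital.assoc
        self.dom_unit_idem coalgebra_map_bas vec_conv_one_left [OF cocomm_coalgebra coord_algebra]
        flip: self.dom_unit_eq) (simp flip: self.unital.assoc)
  then show ?thesis
    using self.smash_conv_hash [OF coalgebra_map_one [OF cocomm_coalgebra] coalgebra_map_bas]
    by (simp add: sharp_bas_eq_hash flip: self.smash_conv_incl_left)
qed

lemma incl_smul:
  assumes "x \<in> B"
  shows "incl q \<diamondop> x = (\<lambda>m. q * x m)"
proof -
  have "incl q \<diamondop> (\<Sum>i\<in>UNIV. sharp H \<phi> act (x i) (bas i))
      = (\<lambda>m. q * (\<Sum>i\<in>UNIV. sharp H \<phi> act (x i) (bas i)) m)"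
    by (simp add: smul_sum_right incl_smul_sharp_bas)
       (simp add: fun_eq_iff sharp_bas sum_distrib_left mult.assoc)
  then show ?thesis
    by (simp flip: smash_set_eq_sum_sharp [OF assms])
qed

lemma gamma_smul_incl: "gamma c k \<diamondop> incl q = gamma (c * q) k"
proof -
  have "conv \<Delta> (const \<epsilon> c) (const \<epsilon> q) = const \<epsilon> (c * q)"
    by (simp add: conv_const_left [OF cocomm_coalgebra] const_def fun_eq_iff phi_left_commute)
  then have "self.crossed_mult (self.point_act bas (const \<epsilon> c), bas)
      (const \<epsilon> q, vec_conv_one \<epsilon> (hone H))
      = (self.point_act bas (const \<epsilon> (c * q)), bas)"
    using self.act_star [of bas "const \<epsilon> c" "const \<epsilon> q"]
    by (simp add: self.crossed_mult_def self.point_cocycle_one self.act_star_dom_unit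
        coalgebra_map_bas vec_conv_one_right [OF cocomm_coalgebra coord_algebra] self.unital.assoc
        flip: self.dom_unit_eq)
  then have "self.smash_conv (gamma c) (self.hash (const \<epsilon> q, vec_conv_one \<epsilon> (hone H)))
      = gamma (c * q)"
    by (simp add: gamma_eq_hash self.smash_conv_hash coalgebra_map_bas coalgebra_map_one
        cocomm_coalgebra)
  from fun_cong [OF this, of k] show ?thesis
    by (simp only: self.smash_conv_incl_right)
qed

lemma smul_incl_in_smash_set:
  assumes "x \<in> B"
  shows "x \<diamondop> incl q \<in> B"
proof -
  have "(\<Sum>i\<in>UNIV. sharp H \<phi> act (x i) (bas i)) \<diamondop> incl q \<in> B"
    by (simp add: smul_sum_left sharp_bas smul_mult_left gamma_smul_incl smash_set_sum
        smash_set_mult gamma_in_smash_set)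
  then show ?thesis
    by (simp flip: smash_set_eq_sum_sharp [OF assms])
qed

abbreviation "\<pi>\<^sub>1 \<equiv> proj_left \<epsilon>"

abbreviation "\<pi>\<^sub>2 \<equiv> proj_right \<epsilon>"

lemmas point_proj_left = coalgebra_map_proj_left [OF cocomm_coalgebra, of \<Delta> \<epsilon>]

lemmas point_proj_right = coalgebra_map_proj_right [OF cocomm_coalgebra, of \<Delta> \<epsilon>]

lemmas pair_proj_square = pair_proj [OF cocomm_coalgebra cocomm_coalgebra]

lemma vec_conv_proj: "vec_conv \<Delta>\<^sub>2 \<mu> \<pi>\<^sub>1 \<pi>\<^sub>2 = \<mu>"
  by (simp add: vec_conv_def pair_proj_square)

text \<open>In the crossed product, \<open>a \<gamma>(h) \<gamma>(k) = \<gamma>(h\<^sub>1 k\<^sub>1) exchange a (h\<^sub>2 \<otimes> k\<^sub>2)\<close>.\<close>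

definition exchange :: "'a \<Rightarrow> 'i \<times> 'i \<Rightarrow> 'a" where
  "exchange a = square.conj \<mu> (conv \<Delta>\<^sub>2 (const \<epsilon>\<^sub>2 a) (square.\<omega> \<pi>\<^sub>1 \<pi>\<^sub>2))"

definition exchange_coord :: "'a \<Rightarrow> 'i \<Rightarrow> 'i \<times> 'i \<Rightarrow> 'a" where
  "exchange_coord a k = conv \<Delta>\<^sub>2 (pull \<mu> (coord k)) (exchange a)"

lemma sharp_smul_gamma:
  assumes c_central: "\<And>a. c * a = a * c"
  shows "sharp H \<phi> act a (bas i) \<diamondop> gamma c j
      = (\<Sum>k\<in>UNIV. gamma c k \<diamondop> incl (exchange_coord a k (i, j)))"
proof
  fix m
  have central: "conv \<Delta>\<^sub>2 (const \<epsilon>\<^sub>2 c) f = conv \<Delta>\<^sub>2 f (const \<epsilon>\<^sub>2 c)" for f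
    by (simp add: conv_const_left [OF cocomm_coalgebra_square]
        conv_const_right [OF cocomm_coalgebra_square] c_central)
  have "(sharp H \<phi> act a (bas i) \<diamondop> gamma c j) m
      = square.smash_conv (square.hash (conv \<Delta>\<^sub>2 (const \<epsilon>\<^sub>2 a) (square.dom_unit \<pi>\<^sub>1), \<pi>\<^sub>1))
          (square.hash (square.point_act \<pi>\<^sub>2 (const \<epsilon>\<^sub>2 c), \<pi>\<^sub>2)) (i, j) m"
    using square.smash_conv_pull [of \<pi>\<^sub>1 "\<lambda>i. sharp H \<phi> act a (bas i)" \<pi>\<^sub>2 "gamma c" "(i, j)" m]
    by (simp add: square.pull_sharp_bas [OF point_proj_left] square.pull_gamma [OF point_proj_right]
        pair_proj_square)
  also have "\<dots> = square.hash (square.point_act \<mu> (conv \<Delta>\<^sub>2 (const \<epsilon>\<^sub>2 c) (exchange a)), \<mu>) (i, j) m"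
    using square.crossed_mult_central [of \<pi>\<^sub>1 \<pi>\<^sub>2, OF _ _ central]
    by (simp add: square.smash_conv_hash point_proj_left point_proj_right vec_conv_proj
        exchange_def)
  also have "\<dots> = bilin (\<Delta>\<^sub>2 (i, j)) (\<lambda>p q. lin (\<mu> p) (\<lambda>k. gamma (c * exchange a q) k m))"
    by (simp add: square.hash_act_eq_gamma [OF coalgebra_map_mult]
        conv_const_left [OF cocomm_coalgebra_square])
  also have "\<dots> = (\<Sum>k\<in>UNIV. bilin (\<Delta>\<^sub>2 (i, j)) (\<lambda>p q. \<phi> (\<mu> p k) * gamma (c * exchange a q) k m))"
    by (simp add: lin_def bilin_sum)
  also have "\<dots> = (\<Sum>k\<in>UNIV. gamma (c * exchange_coord a k (i, j)) k m)"
  proof -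
    have "c * exchange_coord a k (i, j)
        = bilin (\<Delta>\<^sub>2 (i, j)) (\<lambda>p q. \<phi> (\<mu> p k) * (c * exchange a q))" for k
      by (simp add: exchange_coord_def conv_def pull_coord mult_bilin phi_left_commute [of c])
    then show ?thesis by (simp add: gamma_bilin gamma_phi)
  qed
  finally show "(sharp H \<phi> act a (bas i) \<diamondop> gamma c j) m
      = (\<Sum>k\<in>UNIV. gamma c k \<diamondop> incl (exchange_coord a k (i, j))) m"
    by (simp add: gamma_smul_incl)
qed

lemma exchange_gamma_inv:
  "conv \<Delta>\<^sub>2 (exchange a) (pull \<pi>\<^sub>2 (\<lambda>i. gamma_inv i m))
    = pull (pair \<Delta>\<^sub>2 \<mu> \<pi>\<^sub>1) (\<lambda>(q, l). (gamma_inv q \<diamondop> sharp H \<phi> act a (bas l)) m)"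
proof
  fix p
  have "conv \<Delta>\<^sub>2 (exchange a) (pull \<pi>\<^sub>2 (\<lambda>i. gamma_inv i m)) p
      = square.hash (conv \<Delta>\<^sub>2 (exchange a) (square.inv_coeff \<pi>\<^sub>2), square.point_inv \<pi>\<^sub>2) p m"
    unfolding square.star_hash [symmetric]
    by (simp flip: square.pull_gamma_inv [OF point_proj_right])
  also have "\<dots> = square.smash_conv (square.hash (square.inv_coeff \<mu>, square.point_inv \<mu>))
      (square.hash (conv \<Delta>\<^sub>2 (const \<epsilon>\<^sub>2 a) (square.dom_unit \<pi>\<^sub>1), \<pi>\<^sub>1)) p m"
    using square.conj_inv_coeff [of \<pi>\<^sub>1 \<pi>\<^sub>2 "const \<epsilon>\<^sub>2 a"]
      square.smash_conv_hash [of "square.point_inv \<mu>" \<pi>\<^sub>1] square.inv_closed [of \<mu>]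
    by (simp add: point_proj_left point_proj_right coalgebra_map_mult vec_conv_proj exchange_def)
  finally show "conv \<Delta>\<^sub>2 (exchange a) (pull \<pi>\<^sub>2 (\<lambda>i. gamma_inv i m)) p
      = pull (pair \<Delta>\<^sub>2 \<mu> \<pi>\<^sub>1) (\<lambda>(q, l). (gamma_inv q \<diamondop> sharp H \<phi> act a (bas l)) m) p"
    using square.smash_conv_pull [of \<mu> gamma_inv \<pi>\<^sub>1 "\<lambda>l. sharp H \<phi> act a (bas l)" p m]
    by (simp add: square.pull_gamma_inv [OF coalgebra_map_mult]
        square.pull_sharp_bas [OF point_proj_left])
qed

definition gamma_inv_dual :: "('i \<Rightarrow> 'k) \<Rightarrow> 'i \<Rightarrow> 'i \<Rightarrow> 'a" where
  "gamma_inv_dual t j m = lin (\<lambda>q. cop H t (j, q)) (\<lambda>q. gamma_inv q m)"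

lemma sum_lin_cop: "(\<Sum>l\<in>UNIV. lin (\<lambda>q. cop H t (l, q)) (F l)) = lin t (\<lambda>k. bilin (\<Delta> k) F)"
proof -
  have "(\<Sum>l\<in>UNIV. lin (\<lambda>q. cop H t (l, q)) (F l)) = bilin (cop H t) F"
    by (simp add: lin_def bilin_eq_sum)
  then show ?thesis by (simp add: cop_eq_lin bilin_vec_lin)
qed

lemma gamma_inv_dual_in_smash_set: "gamma_inv_dual t j \<in> B"
  unfolding gamma_inv_dual_def [abs_def] by (rule smash_set_lin) (rule gamma_inv_in_smash_set)

text \<open>The integral property in the form \<open>G(h\<^sub>1 t, h\<^sub>2) = G(t, h)\<close>.\<close>

lemma lin_left_integral:
  assumes t_integral: "left_integral H t"
  shows "lin t (\<lambda>k. pull (pair \<Delta>\<^sub>2 \<mu> \<pi>\<^sub>1) (\<lambda>(y, l). G y l) (i, k)) = lin t (\<lambda>k. G k i)"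
proof -
  have integral: "vec.lin t (\<lambda>k. \<mu> (h, k)) = (\<lambda>_. \<epsilon> h) * t" for h
  proof -
    have "hmul H (bas h) t = (\<lambda>l. \<epsilon> h * t l)"
      using t_integral by (simp add: left_integral_def \<epsilon>_def)
    then show ?thesis by (simp add: hmul_eq_lin fun_eq_iff)
  qed
  have "lin t (\<lambda>k. pull (pair \<Delta>\<^sub>2 \<mu> \<pi>\<^sub>1) (\<lambda>(y, l). G y l) (i, k))
      = lin t (\<lambda>k. bilin (\<Delta> i) (\<lambda>h h'. bilin (\<Delta> k)
          (\<lambda>b b'. \<phi> (\<epsilon> b') * lin (\<mu> (h, b)) (\<lambda>y. G y h'))))"
    by (simp add: pull_def lin_pair bilin_tensor_comult lin_proj_left mult_lin)
  also have "\<dots> = bilin (\<Delta> i) (\<lambda>h h'. lin (vec.lin t (\<lambda>k. \<mu> (h, k))) (\<lambda>y. G y h'))"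
    by (simp add: bilin_counit_right [OF cocomm_coalgebra] lin_vec_lin bilin_lin_commute)
  finally show ?thesis
    by (simp add: integral lin_scale bilin_counit_left [OF cocomm_coalgebra])
qed

lemma sum_exchange_gamma_inv_dual:
  "(\<Sum>l\<in>UNIV. incl (exchange_coord a j (i, l)) \<diamondop> gamma_inv_dual t l) m
    = lin t (\<lambda>k. conv \<Delta>\<^sub>2 (exchange_coord a j) (pull \<pi>\<^sub>2 (\<lambda>q. gamma_inv q m)) (i, k))"
proof -
  have "(\<Sum>l\<in>UNIV. incl (exchange_coord a j (i, l)) \<diamondop> gamma_inv_dual t l) m
      = (\<Sum>l\<in>UNIV. lin (\<lambda>q. cop H t (l, q)) (\<lambda>q. exchange_coord a j (i, l) * gamma_inv q m))"
    by (simp add: incl_smul [OF gamma_inv_dual_in_smash_set])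
       (simp add: gamma_inv_dual_def mult_lin)
  also have "\<dots> = lin t (\<lambda>k. bilin (\<Delta> k) (\<lambda>l q. exchange_coord a j (i, l) * gamma_inv q m))"
    by (rule sum_lin_cop)
  finally show ?thesis
    by (simp add: conv_def [of \<Delta>\<^sub>2] pull_def bilin_tensor_comult lin_proj_right phi_left_commute
        bilin_counit_right [OF cocomm_coalgebra] flip: mult_bilin)
qed

lemma gamma_inv_dual_smul_sharp:
  assumes t_integral: "left_integral H t"
  shows "gamma_inv_dual t j \<diamondop> sharp H \<phi> act a (bas i)
    = (\<Sum>l\<in>UNIV. incl (exchange_coord a j (i, l)) \<diamondop> gamma_inv_dual t l)"
proof
  fix m
  let ?S = "\<lambda>q l. (gamma_inv q \<diamondop> sharp H \<phi> act a (bas l)) m"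
  have "(\<Sum>l\<in>UNIV. incl (exchange_coord a j (i, l)) \<diamondop> gamma_inv_dual t l) m
      = lin t (\<lambda>k. conv \<Delta>\<^sub>2 (pull \<mu> (coord j)) (pull (pair \<Delta>\<^sub>2 \<mu> \<pi>\<^sub>1) (\<lambda>(q, l). ?S q l)) (i, k))"
    unfolding sum_exchange_gamma_inv_dual
    by (simp add: exchange_coord_def square.unital.assoc exchange_gamma_inv)
  also have "\<dots> = lin t (\<lambda>k. pull (pair \<Delta>\<^sub>2 \<mu> \<pi>\<^sub>1)
      (\<lambda>(y, l). bilin (\<Delta> y) (\<lambda>p q. coord j p * ?S q l)) (i, k))"
    using pull_pair_comult [OF cocomm_coalgebra_square coalgebra_map_mult, of \<pi>\<^sub>1
        "\<lambda>p q l. coord j p * ?S q l"]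
    by (simp add: conv_pull_eq_pair split_def)
  also have "\<dots> = lin t (\<lambda>k. bilin (\<Delta> k) (\<lambda>p q. coord j p * ?S q i))"
    by (rule lin_left_integral [OF t_integral])
  also have "\<dots> = (\<Sum>p\<in>UNIV. coord j p * lin (\<lambda>q. cop H t (p, q)) (\<lambda>q. ?S q i))"
    by (simp add: mult_lin flip: sum_lin_cop)
  also have "\<dots> = lin (\<lambda>q. cop H t (j, q)) (\<lambda>q. ?S q i)"
  proof -
    have "coord j p * x = (if p = j then x else 0)" for p x
      by (simp add: coord_def bas_def phi_one phi_zero)
    then show ?thesis by simp
  qed
  finally show "(gamma_inv_dual t j \<diamondop> sharp H \<phi> act a (bas i)) m
      = (\<Sum>l\<in>UNIV. incl (exchange_coord a j (i, l)) \<diamondop> gamma_inv_dual t l) m"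
    by (simp add: gamma_inv_dual_def [abs_def] smul_lin_left)
qed

lemma sum_gamma_smul_gamma_inv_dual: "(\<Sum>j\<in>UNIV. gamma c j \<diamondop> gamma_inv_dual t j) = incl (act t c)"
proof
  fix m
  have "self.smash_conv (gamma c) gamma_inv
      = self.hash (self.point_act bas (const \<epsilon> c), vec_conv_one \<epsilon> (hone H))"
    using self.crossed_mult_inv_coeff [of bas "const \<epsilon> c"]
    by (simp add: gamma_eq_hash gamma_inv_eq_hash self.smash_conv_hash coalgebra_map_bas
        coalgebra_map_antipode inv_bas)
  then have "bilin (\<Delta> k) (\<lambda>p q. (gamma c p \<diamondop> gamma_inv q) m) = incl (act_bas k c) m" for k
    by (simp add: fun_eq_iff self.smash_conv_def self.hash_one self.point_act_const)
  moreover have "(\<Sum>j\<in>UNIV. gamma c j \<diamondop> gamma_inv_dual t j) m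
      = lin t (\<lambda>k. bilin (\<Delta> k) (\<lambda>p q. (gamma c p \<diamondop> gamma_inv q) m))"
    by (simp add: gamma_inv_dual_def [abs_def] smul_lin_right flip: sum_lin_cop)
  ultimately show "(\<Sum>j\<in>UNIV. gamma c j \<diamondop> gamma_inv_dual t j) m = incl (act t c) m"
    by (simp add: incl_apply act_eq_lin flip: lin_mult)
qed

lemma gamma_dual_basis:
  assumes x_in_B: "x \<in> B" and t_integral: "left_integral H t" and c_central: "\<And>a. c * a = a * c"
  shows "\<exists>r. (\<forall>j. x \<diamondop> gamma c j = (\<Sum>k\<in>UNIV. gamma c k \<diamondop> incl (r k j))) \<and>
    (\<forall>k. gamma_inv_dual t k \<diamondop> x = (\<Sum>j\<in>UNIV. incl (r k j) \<diamondop> gamma_inv_dual t j))"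
proof (intro exI conjI allI)
  let ?r = "\<lambda>k j. \<Sum>i\<in>UNIV. exchange_coord (x i) k (i, j)"
  have incl_sum: "incl (?r k j) = (\<Sum>i\<in>UNIV. incl (exchange_coord (x i) k (i, j)))" for k j
    by (simp add: fun_eq_iff incl_apply sum_distrib_right)
  show "x \<diamondop> gamma c j = (\<Sum>k\<in>UNIV. gamma c k \<diamondop> incl (?r k j))" for j
    by (subst smash_set_eq_sum_sharp [OF x_in_B])
       (simp only: incl_sum smul_sum_left smul_sum_right sharp_smul_gamma [OF c_central],
        rule sum.swap)
  show "gamma_inv_dual t k \<diamondop> x = (\<Sum>j\<in>UNIV. incl (?r k j) \<diamondop> gamma_inv_dual t j)" for k
    by (subst smash_set_eq_sum_sharp [OF x_in_B])
       (simp only: incl_sum smul_sum_left smul_sum_right gamma_inv_dual_smul_sharp [OF t_integral],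
        rule sum.swap)
qed

end

section \<open>Formal tensors and separability\<close>

lemma vadd_eq_plus: "vadd = (+)"
  by (simp add: fun_eq_iff vadd_def)

lemma delta_apply: "delta z w = (if w = z then 1 else 0)"
  by (simp add: delta_def)

context
  fixes Ms :: "'m::ab_group_add set" and Ns :: "'n::ab_group_add set"
    and ract :: "'m \<Rightarrow> 'r \<Rightarrow> 'm" and lact :: "'r \<Rightarrow> 'n \<Rightarrow> 'n"
  assumes Ms_closed: "0 \<in> Ms" "\<And>x x'. x \<in> Ms \<Longrightarrow> x' \<in> Ms \<Longrightarrow> x + x' \<in> Ms"
    and Ns_closed: "0 \<in> Ns" "\<And>y y'. y \<in> Ns \<Longrightarrow> y' \<in> Ns \<Longrightarrow> y + y' \<in> Ns"
begin

abbreviation "tensor_rels \<equiv> tensor_zero Ms Ns (+) (+) ract lact"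

lemma tensor_rels_zero: "0 \<in> tensor_rels"
  and tensor_rels_add: "p \<in> tensor_rels \<Longrightarrow> q \<in> tensor_rels \<Longrightarrow> p + q \<in> tensor_rels"
  and tensor_rels_uminus: "p \<in> tensor_rels \<Longrightarrow> - p \<in> tensor_rels"
  using tensor_zero.tz_zero tensor_zero.tz_add [of p] tensor_zero.tz_neg [of p]
  by (simp_all add: zero_fun_def plus_fun_def fun_Compl_def)

lemma tensor_rels_diff: "p \<in> tensor_rels \<Longrightarrow> q \<in> tensor_rels \<Longrightarrow> p - q \<in> tensor_rels"
  using tensor_rels_add [of p "- q"] tensor_rels_uminus [of q] by simp

lemma tensor_rels_sum: "(\<And>s. s \<in> S \<Longrightarrow> p s \<in> tensor_rels) \<Longrightarrow> (\<Sum>s\<in>S. p s) \<in> tensor_rels"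
  by (induction S rule: infinite_finite_induct) (simp_all add: tensor_rels_zero tensor_rels_add)

lemma tensor_rels_left_add:
  "\<lbrakk>x \<in> Ms; x' \<in> Ms; y \<in> Ns\<rbrakk> \<Longrightarrow> delta (x + x', y) - delta (x, y) - delta (x', y) \<in> tensor_rels"
  using tensor_zero.tz_l [of x Ms x' y Ns "(+)" "(+)" ract lact] by (simp add: fun_diff_def)

lemma tensor_rels_right_add:
  "\<lbrakk>x \<in> Ms; y \<in> Ns; y' \<in> Ns\<rbrakk> \<Longrightarrow> delta (x, y + y') - delta (x, y) - delta (x, y') \<in> tensor_rels"
  using tensor_zero.tz_r [of x Ms y Ns y' "(+)" "(+)" ract lact] by (simp add: fun_diff_def)

lemma tensor_rels_balanced:
  "\<lbrakk>x \<in> Ms; y \<in> Ns\<rbrakk> \<Longrightarrow> delta (ract x a, y) - delta (x, lact a y) \<in> tensor_rels"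
  using tensor_zero.tz_bal [of x Ms y Ns ract a lact "(+)" "(+)"] by (simp add: fun_diff_def)

lemma tensor_rels_additive_sum:
  fixes D :: "'b::ab_group_add \<Rightarrow> 'm \<times> 'n \<Rightarrow> int"
  assumes X_closed: "0 \<in> X" "\<And>x x'. x \<in> X \<Longrightarrow> x' \<in> X \<Longrightarrow> x + x' \<in> X"
    and D_additive: "\<And>x x'. x \<in> X \<Longrightarrow> x' \<in> X \<Longrightarrow> D (x + x') - D x - D x' \<in> tensor_rels"
    and x_in_X: "\<And>s. s \<in> S \<Longrightarrow> x s \<in> X" and finite_S: "finite S"
  shows "D (\<Sum>s\<in>S. x s) - (\<Sum>s\<in>S. D (x s)) \<in> tensor_rels"
proof -
  have "(\<Sum>s\<in>S. x s) \<in> X \<and> D (\<Sum>s\<in>S. x s) - (\<Sum>s\<in>S. D (x s)) \<in> tensor_rels"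
    using finite_S x_in_X
  proof (induction S rule: finite_induct)
    case empty
    then show ?case
      using X_closed D_additive [of 0 0] tensor_rels_uminus [of "- D 0"] by simp
  next
    case (insert s S)
    have IH: "(\<Sum>s\<in>S. x s) \<in> X" "D (\<Sum>s\<in>S. x s) - (\<Sum>s\<in>S. D (x s)) \<in> tensor_rels"
      using insert by blast+
    have s_in_X: "x s \<in> X" using insert by blast
    have "D (x s + (\<Sum>s\<in>S. x s)) - D (x s) - D (\<Sum>s\<in>S. x s)
        + (D (\<Sum>s\<in>S. x s) - (\<Sum>s\<in>S. D (x s))) \<in> tensor_rels"
      by (intro tensor_rels_add D_additive s_in_X IH)
    also have "D (x s + (\<Sum>s\<in>S. x s)) - D (x s) - D (\<Sum>s\<in>S. x s) + (D (\<Sum>s\<in>S. x s) - (\<Sum>s\<in>S. D (x s)))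
        = D (\<Sum>s\<in>insert s S. x s) - (\<Sum>s\<in>insert s S. D (x s))"
      using insert by (simp add: algebra_simps)
    finally show ?case
      using insert.hyps X_closed(2) [OF s_in_X IH(1)] by simp
  qed
  then show ?thesis ..
qed

lemma tensor_rels_dual_basis:
  fixes g :: "'i::finite \<Rightarrow> 'm" and y :: "'j::finite \<Rightarrow> 'n"
  assumes g_in: "\<And>k. g k \<in> Ms" and y_in: "\<And>j. y j \<in> Ns"
    and ract_in: "\<And>k q. ract (g k) q \<in> Ms" and lact_in: "\<And>j q. lact q (y j) \<in> Ns"
  shows "(\<Sum>j\<in>UNIV. delta (\<Sum>k\<in>UNIV. ract (g k) (r k j), y j))
    - (\<Sum>k\<in>UNIV. delta (g k, \<Sum>j\<in>UNIV. lact (r k j) (y j))) \<in> tensor_rels"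
proof -
  let ?left = "\<lambda>j. delta (\<Sum>k\<in>UNIV. ract (g k) (r k j), y j)"
    and ?right = "\<lambda>k. delta (g k, \<Sum>j\<in>UNIV. lact (r k j) (y j))"
  have "(\<Sum>j\<in>UNIV. ?left j - (\<Sum>k\<in>UNIV. delta (ract (g k) (r k j), y j))) \<in> tensor_rels"
    using ract_in y_in
    by (intro tensor_rels_sum tensor_rels_additive_sum [of Ms "\<lambda>x. delta (x, _)"]
        Ms_closed tensor_rels_left_add) simp_all
  moreover have "(\<Sum>j\<in>UNIV. \<Sum>k\<in>UNIV. delta (ract (g k) (r k j), y j)
      - delta (g k, lact (r k j) (y j))) \<in> tensor_rels"
    by (intro tensor_rels_sum tensor_rels_balanced g_in y_in)
  moreover have "(\<Sum>k\<in>UNIV. ?right k - (\<Sum>j\<in>UNIV. delta (g k, lact (r k j) (y j)))) \<in> tensor_rels"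
    using g_in lact_in
    by (intro tensor_rels_sum tensor_rels_additive_sum [of Ns "\<lambda>y. delta (_, y)"]
        Ns_closed tensor_rels_right_add) simp_all
  moreover have "(\<Sum>k\<in>UNIV. \<Sum>j\<in>UNIV. delta (g k, lact (r k j) (y j)))
      = (\<Sum>j\<in>UNIV. \<Sum>k\<in>UNIV. delta (g k, lact (r k j) (y j)))"
    by (rule sum.swap)
  ultimately show ?thesis
    using tensor_rels_diff [OF tensor_rels_add] by (fastforce simp: sum_subtractf)
qed

end

lemma support_sum_delta: "{z. (\<Sum>i\<in>UNIV. delta (a i)) z \<noteq> 0} \<subseteq> range a"
proof
  fix z assume "z \<in> {z. (\<Sum>i\<in>UNIV. delta (a i)) z \<noteq> 0}"
  then have "(\<Sum>i\<in>UNIV. delta (a i) z) \<noteq> 0" by simp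
  then obtain i where "delta (a i) z \<noteq> 0" by (meson sum.neutral)
  then show "z \<in> range a" by (auto simp: delta_apply split: if_splits)
qed

lemma sum_support_delta:
  fixes f :: "'z \<Rightarrow> 'a::ring_1" and a :: "'i::finite \<Rightarrow> 'z"
  defines "p \<equiv> \<Sum>i\<in>UNIV. delta (a i)"
  shows "(\<Sum>z | p z \<noteq> 0 \<and> Q z. of_int (p z) * f z) = (\<Sum>i\<in>UNIV. if Q (a i) then f (a i) else 0)"
proof -
  have "(\<Sum>z | p z \<noteq> 0 \<and> Q z. of_int (p z) * f z)
      = (\<Sum>z\<in>range a. if Q z then of_int (p z) * f z else 0)"
    using support_sum_delta [of a]
    by (intro sum.mono_neutral_cong_left) (auto simp: p_def simp del: of_int_sum)
  also have "\<dots> = (\<Sum>z\<in>range a. \<Sum>i\<in>UNIV. if z = a i then (if Q z then f z else 0) else 0)"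
    by (intro sum.cong refl) (auto simp: p_def delta_apply of_int_sum sum_distrib_right
        intro!: sum.cong)
  also have "\<dots> = (\<Sum>i\<in>UNIV. \<Sum>z\<in>range a. if z = a i then (if Q z then f z else 0) else 0)"
    by (rule sum.swap)
  also have "\<dots> = (\<Sum>i\<in>UNIV. if Q (a i) then f (a i) else 0)"
    by simp
  finally show ?thesis .
qed

lemma push_sum_delta:
  fixes a :: "'i::finite \<Rightarrow> 'z"
  shows "push g (\<Sum>i\<in>UNIV. delta (a i)) = (\<Sum>i\<in>UNIV. delta (g (a i)))"
proof
  fix w
  show "push g (\<Sum>i\<in>UNIV. delta (a i)) w = (\<Sum>i\<in>UNIV. delta (g (a i))) w"
    using sum_support_delta [where a=a and Q="\<lambda>z. g z = w" and f="\<lambda>_. 1 :: int"]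
    by (simp add: push_def delta_apply eq_commute [of w])
qed

context sym_twisted_partial_action
begin

lemma smash_separableI_dual_basis:
  fixes g y :: "'i \<Rightarrow> 'i \<Rightarrow> 'a"
  assumes g_in: "\<And>k. g k \<in> B" and y_in: "\<And>j. y j \<in> B"
    and dual: "\<And>x. x \<in> B \<Longrightarrow> \<exists>r. (\<forall>j. x \<diamondop> g j = (\<Sum>k\<in>UNIV. g k \<diamondop> incl (r k j))) \<and>
      (\<forall>k. y k \<diamondop> x = (\<Sum>j\<in>UNIV. incl (r k j) \<diamondop> y j))"
    and sum_eq_one: "(\<Sum>j\<in>UNIV. g j \<diamondop> y j) = incl 1"
  shows "smash_separable H \<phi> act om"
  unfolding smash_separable_def vadd_eq_plus
proof (intro exI [of _ "\<Sum>j\<in>UNIV. delta (g j, y j)"] conjI ballI)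
  let ?p = "\<Sum>j\<in>UNIV. delta (g j, y j)"
  have supp: "{z. ?p z \<noteq> 0} \<subseteq> range (\<lambda>j. (g j, y j))"
    by (rule support_sum_delta)
  then show "finite {z. ?p z \<noteq> 0}"
    by (rule finite_subset) simp
  show "{z. ?p z \<noteq> 0} \<subseteq> B \<times> B"
    using supp g_in y_in by fastforce
  fix x assume "x \<in> B"
  from dual [OF this] obtain r where
    "\<And>j. x \<diamondop> g j = (\<Sum>k\<in>UNIV. g k \<diamondop> incl (r k j))" "\<And>k. y k \<diamondop> x = (\<Sum>j\<in>UNIV. incl (r k j) \<diamondop> y j)"
    by blast
  then show "(\<lambda>w. push (\<lambda>z. (x \<diamondop> fst z, snd z)) ?p w - push (\<lambda>z. (fst z, snd z \<diamondop> x)) ?p w)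
      \<in> tensor_zero B B (+) (+) (\<lambda>x a. x \<diamondop> incl a) (\<lambda>a y. incl a \<diamondop> y)"
    using tensor_rels_dual_basis [of B B g y "\<lambda>x a. x \<diamondop> incl a" "\<lambda>a y. incl a \<diamondop> y" r]
    by (simp add: push_sum_delta fun_diff_def smash_set_zero smash_set_add g_in y_in
        smul_incl_in_smash_set incl_smul smash_set_mult)
next
  let ?p = "\<Sum>j\<in>UNIV. delta (g j, y j)"
  have "(\<Sum>z | ?p z \<noteq> 0. of_int (?p z) * (fst z \<diamondop> snd z) m) = (\<Sum>j\<in>UNIV. g j \<diamondop> y j) m" for m
    using sum_support_delta [where a="\<lambda>j. (g j, y j)" and Q="\<lambda>_. True"
        and f="\<lambda>z. (fst z \<diamondop> snd z) m"] by simp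
  then show "(\<lambda>m. \<Sum>z | ?p z \<noteq> 0. of_int (?p z) * (fst z \<diamondop> snd z) m) = incl 1"
    by (simp only: sum_eq_one)
qed

end

theorem theorem6p2:
  fixes H :: "('i::finite, 'k::field) hopf_data"
    and \<phi> :: "'k \<Rightarrow> 'a::ring_1"
    and act :: "('i \<Rightarrow> 'k) \<Rightarrow> 'a \<Rightarrow> 'a"
    and om om' :: "('i \<Rightarrow> 'k) \<Rightarrow> ('i \<Rightarrow> 'k) \<Rightarrow> 'a"
    and t :: "'i \<Rightarrow> 'k"
    and c :: 'a
  assumes "is_hopf H"
    and "cocommutative H"
    and "kalg \<phi>"
    and "sym_tpa H \<phi> act om om'"
    and "left_integral H t"
    and "t \<noteq> (\<lambda>_. 0)"
    and "\<forall>a. c * a = a * c"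
    and "act t c = 1"
  shows "smash_separable H \<phi> act om"
proof -
  interpret sym_twisted_partial_action \<phi> H act om om'
    using assms by unfold_locales
  show ?thesis
  proof (rule smash_separableI_dual_basis)
    show "gamma c k \<in> B" "gamma_inv_dual t k \<in> B" for k
      by (rule gamma_in_smash_set gamma_inv_dual_in_smash_set)+
    show "(\<Sum>j\<in>UNIV. gamma c j \<diamondop> gamma_inv_dual t j) = incl 1"
      by (simp add: sum_gamma_smul_gamma_inv_dual assms)
    show "\<exists>r. (\<forall>j. x \<diamondop> gamma c j = (\<Sum>k\<in>UNIV. gamma c k \<diamondop> incl (r k j))) \<and>
        (\<forall>k. gamma_inv_dual t k \<diamondop> x = (\<Sum>j\<in>UNIV. incl (r k j) \<diamondop> gamma_inv_dual t j))"
      if "x \<in> B" for x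
      by (rule gamma_dual_basis [OF that]) (use assms in blast)+
  qed
qed

end
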